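(* Let $G$ be a finite group, $F$ a field with $\operatorname{char}(F)\nmid |G|$, and $(A/F,\varphi_A)$ a Galois $(G,F)$-algebra. For each primitive (central) idempotent $e\in A$, let $G_e:=\operatorname{Stab}_G(e)$ be its stabilizer. Then the component $eA$ is a Galois $G_e$-extension field of $F$, with group isomorphism $\varphi_{eA}:G_e\to\operatorname{Gal}(eA/F)$ defined by $g\mapsto\varphi_A(g)|_{eA}$. In particular, $A\cong\operatorname{Ind}^G_{G_e}(eA)$ as Galois $(G,F)$-algebras.
   Context: A Galois $(G,F)$-algebra is a pair $(A/F,\varphi_A)$ where $A$ is an étale $F$-algebra of degree (dimension) $|G|$ over $F$ and $\varphi_A:G\hookrightarrow\operatorname{Aut}_F(A)$ is an injective homomorphism (a $G$-action) such that $A^G=F$. A morphism of Galois $(G,F)$-algebras $A\to B$ is a morphism of $F$-algebras $f$ with $f\circ\varphi_A(g)=\varphi_B(g)\circ f$ for all $g\in G$. If $A$ is a field it is called a Galois $G$-extension (field) of $F$. Idempotents are by convention nonzero. $G$ acts on idempotents via $\varphi_A$. Induced algebra: for a subgroup $H\subseteq G$ and an $F$-algebra $B$ with an $H$-action by $F$-algebra automorphisms, $\operatorname{Ind}^G_H B:=\{\tau\in\operatorname{Map}(G,B)\mid \tau(hg)=h\tau(g)\ \forall h\in H,\ g\in G\}$, with pointwise addition, multiplication and $F$-scalars, and with $G$-action $(x\cdot\tau)(g)=\tau(gx)$ for $x,g\in G$. *)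

theory Defs
  imports
    "HOL-Algebra.Module"
    "HOL-Algebra.Bij"
    "HOL-Algebra.Group_Action"
    "HOL-Algebra.Multiplicative_Group"
    "HOL-Algebra.Embedded_Algebras"
    "HOL-Algebra.Finite_Extensions"
begin

text \<open>The order of an element of infinite order is \<open>0\<close> in the library, so this is the usual
  characteristic, including characteristic \<open>0\<close>.\<close>
definition characteristic :: "('a, 'm) ring_scheme \<Rightarrow> nat" where
  "characteristic R = group.ord (add_monoid R) \<one>\<^bsub>R\<^esub>"


section \<open>Algebras over a field\<close>

text \<open>The library's \<^locale>\<open>algebra\<close> (commutative, unital) is used for $F$-algebras, so that the
  unit of the component $eA$ can be $e$.  Its notions of dimension and minimal polynomial
  are relative to a subfield of the ring itself; that subfield is the copy
  \<open>scalars F A\<close> of $F$ inside $A$.\<close>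

definition scalars :: "('f, 'k) ring_scheme \<Rightarrow> ('f, 'a, 'm) module_scheme \<Rightarrow> 'a set" where
  "scalars F A = (\<lambda>k. k \<odot>\<^bsub>A\<^esub> \<one>\<^bsub>A\<^esub>) ` carrier F"

definition alg_hom ::
    "('f, 'k) ring_scheme \<Rightarrow> ('f, 'a, 'm) module_scheme \<Rightarrow> ('f, 'b, 'n) module_scheme
      \<Rightarrow> ('a \<Rightarrow> 'b) set" where
  "alg_hom F A B = {f \<in> ring_hom A B.
     \<forall>k \<in> carrier F. \<forall>x \<in> carrier A. f (k \<odot>\<^bsub>A\<^esub> x) = k \<odot>\<^bsub>B\<^esub> f x}"

definition alg_iso ::
    "('f, 'k) ring_scheme \<Rightarrow> ('f, 'a, 'm) module_scheme \<Rightarrow> ('f, 'b, 'n) module_scheme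
      \<Rightarrow> ('a \<Rightarrow> 'b) set" where
  "alg_iso F A B = {f \<in> alg_hom F A B. bij_betw f (carrier A) (carrier B)}"

text \<open>$\mathrm{Aut}_F(A)$, which is also $\mathrm{Gal}(A/F)$ when $A$ is a field.  As in
  \<^const>\<open>AutoGroup\<close>, its elements are extensional functions on the carrier.\<close>
definition Aut_alg ::
    "('f, 'k) ring_scheme \<Rightarrow> ('f, 'a, 'm) module_scheme \<Rightarrow> ('a \<Rightarrow> 'a) monoid" where
  "Aut_alg F A = BijGroup (carrier A) \<lparr>carrier := alg_hom F A A \<inter> Bij (carrier A)\<rparr>"

definition prod_algebra ::
    "'i set \<Rightarrow> ('i \<Rightarrow> ('f, 'a, 'm) module_scheme) \<Rightarrow> ('f, 'i \<Rightarrow> 'a) module" where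
  "prod_algebra I L = \<lparr>
     carrier = (\<Pi>\<^sub>E i\<in>I. carrier (L i)),
     monoid.mult = \<lambda>x y. \<lambda>i\<in>I. x i \<otimes>\<^bsub>L i\<^esub> y i,
     one = \<lambda>i\<in>I. \<one>\<^bsub>L i\<^esub>,
     zero = \<lambda>i\<in>I. \<zero>\<^bsub>L i\<^esub>,
     add = \<lambda>x y. \<lambda>i\<in>I. x i \<oplus>\<^bsub>L i\<^esub> y i,
     smult = \<lambda>k x. \<lambda>i\<in>I. k \<odot>\<^bsub>L i\<^esub> x i\<rparr>"


section \<open>Separable extensions and etale algebras\<close>

text \<open>Polynomials are lists of coefficients, leading coefficient first: in \<open>p\<close> of degree \<open>n\<close>,
  the entry \<open>p ! i\<close> is the coefficient of $X^{n-i}$.\<close>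
definition (in ring) poly_deriv :: "'a list \<Rightarrow> 'a list" where
  "poly_deriv p = normalize (map (\<lambda>i. add_pow R (degree p - i) (p ! i)) [0..<degree p])"

definition (in ring) separable_poly :: "'a set \<Rightarrow> 'a list \<Rightarrow> bool" where
  "separable_poly K p \<longleftrightarrow>
     (\<forall>d \<in> carrier (K[X]). d divides\<^bsub>K[X]\<^esub> p \<and> d divides\<^bsub>K[X]\<^esub> poly_deriv p \<longrightarrow> d \<in> Units (K[X]))"

definition finite_separable_extension ::
    "('f, 'k) ring_scheme \<Rightarrow> ('f, 'a, 'm) module_scheme \<Rightarrow> bool" where
  "finite_separable_extension F L \<longleftrightarrow>
     algebra F L \<and> field L \<and>
     ring.finite_dimension L (scalars F L) (carrier L) \<and>
     (\<forall>x \<in> carrier L. ring.separable_poly L (scalars F L) (ring.Irr L (scalars F L) x))"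

text \<open>Taking the factors on the element type of \<open>A\<close> is no restriction: each factor of a product
  isomorphic to \<open>A\<close> is isomorphic to a component \<open>eA\<close>, whose carrier is a subset of \<open>A\<close>.\<close>
definition etale ::
    "('f, 'k) ring_scheme \<Rightarrow> ('f, 'a, 'm) module_scheme \<Rightarrow> bool" where
  "etale F A \<longleftrightarrow>
     algebra F A \<and>
     (\<exists>(n::nat) (L :: nat \<Rightarrow> ('f, 'a) module).
        (\<forall>i<n. finite_separable_extension F (L i)) \<and>
        alg_iso F A (prod_algebra {..<n} L) \<noteq> {})"


section \<open>Galois algebras\<close>

locale galois_algebra = group G + F: field F + A: algebra F A
  for G :: "('g, 'p) monoid_scheme" (structure)
    and F :: "('f, 'k) ring_scheme"
    and A :: "('f, 'a, 'm) module_scheme"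
    and \<phi> :: "'g \<Rightarrow> 'a \<Rightarrow> 'a" +
  assumes finite_group: "finite (carrier G)"
    and etale: "etale F A"
    and degree: "ring.dimension A (order G) (scalars F A) (carrier A)"
    and action_hom: "\<phi> \<in> hom G (Aut_alg F A)"
    and action_inj: "inj_on \<phi> (carrier G)"
    and invariants: "{a \<in> carrier A. \<forall>g \<in> carrier G. \<phi> g a = a} = scalars F A"

definition galois_extension_field ::
    "('g, 'p) monoid_scheme \<Rightarrow> ('f, 'k) ring_scheme \<Rightarrow> ('f, 'a, 'm) module_scheme
      \<Rightarrow> ('g \<Rightarrow> 'a \<Rightarrow> 'a) \<Rightarrow> bool" where
  "galois_extension_field G F A \<phi> \<longleftrightarrow> galois_algebra G F A \<phi> \<and> field A"

definition galois_algebra_hom ::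
    "('g, 'p) monoid_scheme \<Rightarrow> ('f, 'k) ring_scheme
      \<Rightarrow> ('f, 'a, 'm) module_scheme \<Rightarrow> ('g \<Rightarrow> 'a \<Rightarrow> 'a)
      \<Rightarrow> ('f, 'b, 'n) module_scheme \<Rightarrow> ('g \<Rightarrow> 'b \<Rightarrow> 'b) \<Rightarrow> ('a \<Rightarrow> 'b) set" where
  "galois_algebra_hom G F A \<phi> B \<psi> = {f \<in> alg_hom F A B.
     \<forall>g \<in> carrier G. \<forall>a \<in> carrier A. f (\<phi> g a) = \<psi> g (f a)}"

definition galois_algebra_isomorphic ::
    "('g, 'p) monoid_scheme \<Rightarrow> ('f, 'k) ring_scheme
      \<Rightarrow> ('f, 'a, 'm) module_scheme \<Rightarrow> ('g \<Rightarrow> 'a \<Rightarrow> 'a)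
      \<Rightarrow> ('f, 'b, 'n) module_scheme \<Rightarrow> ('g \<Rightarrow> 'b \<Rightarrow> 'b) \<Rightarrow> bool" where
  "galois_algebra_isomorphic G F A \<phi> B \<psi> \<longleftrightarrow>
     galois_algebra G F A \<phi> \<and> galois_algebra G F B \<psi> \<and>
     (\<exists>f \<in> galois_algebra_hom G F A \<phi> B \<psi>. bij_betw f (carrier A) (carrier B))"


section \<open>Idempotents and components\<close>

definition idempotents :: "('a, 'm) ring_scheme \<Rightarrow> 'a set" where
  "idempotents A = {e \<in> carrier A. e \<otimes>\<^bsub>A\<^esub> e = e \<and> e \<noteq> \<zero>\<^bsub>A\<^esub>}"

definition primitive_idempotents :: "('a, 'm) ring_scheme \<Rightarrow> 'a set" where
  "primitive_idempotents A = {e \<in> idempotents A.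
     \<not> (\<exists>u \<in> idempotents A. \<exists>v \<in> idempotents A.
          u \<otimes>\<^bsub>A\<^esub> v = \<zero>\<^bsub>A\<^esub> \<and> v \<otimes>\<^bsub>A\<^esub> u = \<zero>\<^bsub>A\<^esub> \<and> e = u \<oplus>\<^bsub>A\<^esub> v)}"

definition component :: "('f, 'a, 'm) module_scheme \<Rightarrow> 'a \<Rightarrow> ('f, 'a, 'm) module_scheme" where
  "component A e = A \<lparr>carrier := (\<lambda>a. e \<otimes>\<^bsub>A\<^esub> a) ` carrier A, one := e\<rparr>"

definition component_action ::
    "('f, 'a, 'm) module_scheme \<Rightarrow> ('g \<Rightarrow> 'a \<Rightarrow> 'a) \<Rightarrow> 'a \<Rightarrow> 'g \<Rightarrow> 'a \<Rightarrow> 'a" where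
  "component_action A \<phi> e g = restrict (\<phi> g) (carrier (component A e))"


section \<open>Induced algebras\<close>

definition Ind ::
    "('g, 'p) monoid_scheme \<Rightarrow> 'g set \<Rightarrow> ('f, 'b, 'm) module_scheme \<Rightarrow> ('g \<Rightarrow> 'b \<Rightarrow> 'b)
      \<Rightarrow> ('f, 'g \<Rightarrow> 'b) module" where
  "Ind G H B \<psi> = \<lparr>
     carrier = {\<tau> \<in> carrier G \<rightarrow>\<^sub>E carrier B.
                  \<forall>h \<in> H. \<forall>g \<in> carrier G. \<tau> (h \<otimes>\<^bsub>G\<^esub> g) = \<psi> h (\<tau> g)},
     monoid.mult = \<lambda>\<sigma> \<tau>. \<lambda>g\<in>carrier G. \<sigma> g \<otimes>\<^bsub>B\<^esub> \<tau> g,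
     one = \<lambda>g\<in>carrier G. \<one>\<^bsub>B\<^esub>,
     zero = \<lambda>g\<in>carrier G. \<zero>\<^bsub>B\<^esub>,
     add = \<lambda>\<sigma> \<tau>. \<lambda>g\<in>carrier G. \<sigma> g \<oplus>\<^bsub>B\<^esub> \<tau> g,
     smult = \<lambda>k \<tau>. \<lambda>g\<in>carrier G. k \<odot>\<^bsub>B\<^esub> \<tau> g\<rparr>"

definition Ind_action ::
    "('g, 'p) monoid_scheme \<Rightarrow> 'g set \<Rightarrow> ('f, 'b, 'm) module_scheme \<Rightarrow> ('g \<Rightarrow> 'b \<Rightarrow> 'b)
      \<Rightarrow> 'g \<Rightarrow> ('g \<Rightarrow> 'b) \<Rightarrow> 'g \<Rightarrow> 'b" where
  "Ind_action G H B \<psi> x =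
     (\<lambda>\<tau>\<in>carrier (Ind G H B \<psi>). \<lambda>g\<in>carrier G. \<tau> (g \<otimes>\<^bsub>G\<^esub> x))"

end

theory Submission
  imports Defs
begin

text \<open>The sum of the orbit of \<open>e\<close> is an invariant idempotent, hence a scalar, hence \<open>1\<close>.  So \<open>A\<close>
  is the direct sum of the components \<open>uA\<close> for \<open>u\<close> in the orbit, which \<open>G\<close> permutes transitively,
  and counting dimensions gives $[eA : F] = |G_e|$.  Gluing an invariant of \<open>eA\<close> along the orbit
  produces an invariant of \<open>A\<close>, so the invariants of \<open>eA\<close> under $G_e$ are the scalars.  Artin's bound
  then says that the image of $G_e$ in $\mathrm{Aut}_F(eA)$ has at least $[eA : F] = |G_e|$ elements,
  and Dedekind's bound says that $\mathrm{Aut}_F(eA)$ has at most that many.  The isomorphism with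
  the induced algebra sends \<open>a\<close> to the function $g \mapsto e \cdot ga$.  Its components, isomorphic to
  \<open>eA\<close>, are separable because the degree of a minimal polynomial divides \<open>|G|\<close>: it is nonzero in \<open>F\<close>,
  so the derivative does not vanish.\<close>

section \<open>Linear algebra over a field\<close>

text \<open>The obstacle is faithfulness on the component. An element of the stabilizer that fixes
  \<open>eA\<close> pointwise could still move the other components, so injectivity of
  \<open>\<phi>\<close> says nothing directly about the restriction to \<open>eA\<close>.
  Surjectivity onto the automorphism group is not visible either. Both are therefore extracted from
  cardinalities, and the order of the argument follows from that: the invariants and the dimension
  of \<open>eA\<close> must be known before its action is known to be faithful. The number |G_e|
  arises because the components along the orbit all have the same dimension and these add up to |G|,
  so that the orbit-stabilizer theorem identifies the common value.\<close>

lemma (in abelian_monoid) finsum_swap: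
  assumes "finite I" "finite J" "\<And>i j. i \<in> I \<Longrightarrow> j \<in> J \<Longrightarrow> f i j \<in> carrier G"
  shows "(\<Oplus>i\<in>I. \<Oplus>j\<in>J. f i j) = (\<Oplus>j\<in>J. \<Oplus>i\<in>I. f i j)"
  using assms(1,3)
proof (induction I rule: finite_induct)
  case empty
  then show ?case by simp
next
  case (insert i I)
  then have "(\<Oplus>i\<in>insert i I. \<Oplus>j\<in>J. f i j)
      = (\<Oplus>j\<in>J. f i j) \<oplus> (\<Oplus>j\<in>J. \<Oplus>i\<in>I. f i j)"
    by (subst finsum_insert) (auto intro!: finsum_closed)
  also have "\<dots> = (\<Oplus>j\<in>J. f i j \<oplus> (\<Oplus>i\<in>I. f i j))"
    using insert.prems by (intro finsum_addf[symmetric]) (auto intro!: finsum_closed)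
  also have "\<dots> = (\<Oplus>j\<in>J. \<Oplus>i\<in>insert i I. f i j)"
    using insert by (intro finsum_cong') (auto intro!: finsum_closed)
  finally show ?case .
qed

text \<open>Gaussian elimination by induction on the equations. A nonzero coefficient of equation
  \<open>i0\<close> serves as a pivot and removes one equation together with one unknown, so the
  inequality of cardinalities survives. The index sets are arbitrary because automorphisms index the
  unknowns in Dedekind's bound and the equations in Artin's.\<close>

lemma (in field) homogeneous_system_nontrivial_solution:
  assumes "finite I" "finite J" "card I < card J"
    and "\<And>i j. i \<in> I \<Longrightarrow> j \<in> J \<Longrightarrow> M i j \<in> carrier R"
  shows "\<exists>x \<in> J \<rightarrow> carrier R. (\<exists>j\<in>J. x j \<noteq> \<zero>) \<and> (\<forall>i\<in>I. (\<Oplus>j\<in>J. M i j \<otimes> x j) = \<zero>)"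
  using assms
proof (induction I arbitrary: J M rule: finite_induct)
  case empty
  then have "J \<noteq> {}" by auto
  then show ?case by (intro bexI[of _ "\<lambda>_. \<one>"]) auto
next
  case (insert i0 I)
  show ?case
  proof (cases "\<forall>j\<in>J. M i0 j = \<zero>")
    case True
    obtain x where x: "x \<in> J \<rightarrow> carrier R" "\<exists>j\<in>J. x j \<noteq> \<zero>"
      "\<forall>i\<in>I. (\<Oplus>j\<in>J. M i j \<otimes> x j) = \<zero>"
      using insert.IH[of J M] insert.prems insert.hyps by auto
    have "(\<Oplus>j\<in>J. M i0 j \<otimes> x j) = \<zero>"
      using True x(1) by (intro add.finprod_one_eqI) (auto simp: Pi_def)
    with x show ?thesis by auto
  next
    case False
    then obtain j0 where j0: "j0 \<in> J" "M i0 j0 \<noteq> \<zero>" by auto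
    define J' where "J' = J - {j0}"
    define p where "p = M i0 j0"
    \<comment> \<open>Adding \<open>c i\<close> times row \<open>i0\<close> to row \<open>i\<close>
      clears the coefficient of the unknown \<open>j0\<close>. For \<open>i0\<close> itself the
      factor is -1, which lets one formula \<open>row\<close> treat all equations.\<close>
    define c where "c i = \<ominus> (M i j0 \<otimes> inv p)" for i
    have M: "M i j \<in> carrier R" if "i \<in> insert i0 I" "j \<in> J" for i j
      using insert.prems that by auto
    have p: "p \<in> carrier R" "inv p \<in> carrier R" "p \<otimes> inv p = \<one>"
      using j0 M field_Units by (auto simp: p_def)
    have c: "c i \<in> carrier R" if "i \<in> insert i0 I" for i
      using M[OF that j0(1)] p by (auto simp: c_def)
    have J': "finite J'" "J = insert j0 J'" "j0 \<notin> J'" "J' \<subseteq> J"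
      using j0 insert.prems by (auto simp: J'_def)
    have "card I < card J'"
      using insert.prems insert.hyps J' by auto
    then have "\<exists>y \<in> J' \<rightarrow> carrier R. (\<exists>j\<in>J'. y j \<noteq> \<zero>) \<and>
        (\<forall>i\<in>I. (\<Oplus>j\<in>J'. (M i j \<oplus> c i \<otimes> M i0 j) \<otimes> y j) = \<zero>)"
      using J' M c by (intro insert.IH) auto
    then obtain y where y: "y \<in> J' \<rightarrow> carrier R" "\<exists>j\<in>J'. y j \<noteq> \<zero>"
      "\<And>i. i \<in> I \<Longrightarrow> (\<Oplus>j\<in>J'. (M i j \<oplus> c i \<otimes> M i0 j) \<otimes> y j) = \<zero>"
      by blast
    have yc: "y j \<in> carrier R" if "j \<in> J'" for j
      using y that by auto
    define S where "S i = (\<Oplus>j\<in>J'. M i j \<otimes> y j)" for i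
    have S: "S i \<in> carrier R" if "i \<in> insert i0 I" for i
      unfolding S_def using M that y(1) J' by (intro finsum_closed) auto
    \<comment> \<open>Back substitution: the value at \<open>j0\<close> is the one that equation
      \<open>i0\<close> dictates.\<close>
    define x where "x = y(j0 := \<ominus> (inv p \<otimes> S i0))"
    have xJ: "x \<in> J \<rightarrow> carrier R"
      using y(1) J' p S by (auto simp: x_def)
    have row: "(\<Oplus>j\<in>J. M i j \<otimes> x j) = c i \<otimes> S i0 \<oplus> S i" if i: "i \<in> insert i0 I" for i
    proof -
      have "(\<Oplus>j\<in>J. M i j \<otimes> x j) = M i j0 \<otimes> x j0 \<oplus> (\<Oplus>j\<in>J'. M i j \<otimes> x j)"
        unfolding J'(2) using J' xJ M i by (intro finsum_insert) auto
      also have "(\<Oplus>j\<in>J'. M i j \<otimes> x j) = S i"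
        unfolding S_def using J' yc M i by (intro finsum_cong') (auto simp: x_def)
      also have "M i j0 \<otimes> x j0 = c i \<otimes> S i0"
        using M[OF i j0(1)] p S[of i0] by (simp add: x_def c_def m_assoc l_minus r_minus)
      finally show ?thesis .
    qed
    have "c i0 = \<ominus> \<one>"
      using p by (simp add: c_def p_def[symmetric])
    then have "(\<Oplus>j\<in>J. M i0 j \<otimes> x j) = \<zero>"
      using S[of i0] row[of i0] by (simp add: l_minus l_neg)
    moreover have "(\<Oplus>j\<in>J. M i j \<otimes> x j) = \<zero>" if i: "i \<in> I" for i
    proof -
      have "(\<Oplus>j\<in>J'. (M i j \<oplus> c i \<otimes> M i0 j) \<otimes> y j)
          = (\<Oplus>j\<in>J'. M i j \<otimes> y j \<oplus> c i \<otimes> (M i0 j \<otimes> y j))"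
        using M c i J' yc by (intro finsum_cong') (auto simp: l_distr m_assoc subset_eq)
      also have "\<dots> = S i \<oplus> (\<Oplus>j\<in>J'. c i \<otimes> (M i0 j \<otimes> y j))"
        unfolding S_def using M c i J' yc by (intro finsum_addf) auto
      also have "\<dots> = S i \<oplus> c i \<otimes> S i0"
        unfolding S_def using M c i J' yc by (subst finsum_rdistr) auto
      finally show ?thesis
        using y(3)[OF i] row[of i] i S c by (simp add: a_comm)
    qed
    moreover have "\<exists>j\<in>J. x j \<noteq> \<zero>"
      using y(2) J' by (auto simp: x_def)
    ultimately show ?thesis using xJ by auto
  qed
qed

text \<open>Dedekind's argument. The relation at \<open>y \<otimes> x\<close> minus
  \<open>\<tau> y\<close> times the relation at \<open>x\<close> has no \<open>\<tau>\<close>-term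
  left, so the induction hypothesis kills each coefficient
  \<open>c \<rho> \<otimes> (\<rho> y \<ominus> \<tau> y)\<close>. Extensionality guarantees that
  distinct members of \<open>S\<close> differ at some \<open>y\<close> in the carrier.\<close>

lemma (in domain) independence_of_characters:
  assumes "finite S" "S \<subseteq> ring_hom R R" "S \<subseteq> extensional (carrier R)"
    and "c \<in> S \<rightarrow> carrier R"
    and "\<And>x. x \<in> carrier R \<Longrightarrow> (\<Oplus>\<sigma>\<in>S. c \<sigma> \<otimes> \<sigma> x) = \<zero>"
  shows "\<forall>\<sigma>\<in>S. c \<sigma> = \<zero>"
  using assms
proof (induction S arbitrary: c rule: finite_induct)
  case empty
  then show ?case by simp
next
  case (insert \<tau> S)
  have hom: "\<sigma> \<in> ring_hom R R" if "\<sigma> \<in> insert \<tau> S" for \<sigma>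
    using that insert.prems by auto
  have cl: "\<sigma> x \<in> carrier R" if "\<sigma> \<in> insert \<tau> S" "x \<in> carrier R" for \<sigma> x
    using hom[OF that(1)] that(2) by (rule ring_hom_closed)
  have c: "c \<sigma> \<in> carrier R" if "\<sigma> \<in> insert \<tau> S" for \<sigma>
    using that insert.prems by auto
  have split: "(\<Oplus>\<sigma>\<in>S. c \<sigma> \<otimes> \<sigma> x) = \<ominus> (c \<tau> \<otimes> \<tau> x)" if x: "x \<in> carrier R" for x
  proof -
    have "c \<tau> \<otimes> \<tau> x \<oplus> (\<Oplus>\<sigma>\<in>S. c \<sigma> \<otimes> \<sigma> x) = \<zero>"
      using insert.prems(4)[OF x] insert.hyps cl c x by (subst (asm) finsum_insert) auto
    then show ?thesis
      using cl c x by (intro sum_zero_eq_neg) (auto simp: a_comm intro!: finsum_closed)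
  qed
  have zero: "c \<sigma> = \<zero>" if \<sigma>: "\<sigma> \<in> S" for \<sigma>
  proof -
    have "\<sigma> \<noteq> \<tau>" using \<sigma> insert.hyps by auto
    then obtain y where y: "y \<in> carrier R" "\<sigma> y \<noteq> \<tau> y"
      using extensionalityI[of \<sigma> "carrier R" \<tau>] insert.prems(2) \<sigma> by blast
    define d where "d \<rho> = c \<rho> \<otimes> (\<rho> y \<ominus> \<tau> y)" for \<rho>
    have "(\<Oplus>\<rho>\<in>S. d \<rho> \<otimes> \<rho> x) = \<zero>" if x: "x \<in> carrier R" for x
    proof -
      have "(\<Oplus>\<rho>\<in>S. d \<rho> \<otimes> \<rho> x)
          = (\<Oplus>\<rho>\<in>S. c \<rho> \<otimes> \<rho> (y \<otimes> x) \<oplus> (\<ominus> \<tau> y) \<otimes> (c \<rho> \<otimes> \<rho> x))"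
      proof (intro finsum_cong')
        fix \<rho> assume \<rho>: "\<rho> \<in> S"
        then have "\<rho> (y \<otimes> x) = \<rho> y \<otimes> \<rho> x"
          using ring_hom_mult[OF hom, of \<rho> y x] y x by simp
        then show "d \<rho> \<otimes> \<rho> x = c \<rho> \<otimes> \<rho> (y \<otimes> x) \<oplus> (\<ominus> \<tau> y) \<otimes> (c \<rho> \<otimes> \<rho> x)"
          using c[of \<rho>] cl[of \<rho> x] cl[of \<rho> y] cl[of \<tau> y] y x \<rho>
          by (simp add: d_def minus_eq l_distr r_distr m_assoc l_minus r_minus m_lcomm)
      qed (use c cl y x in auto)
      also have "\<dots> = (\<Oplus>\<rho>\<in>S. c \<rho> \<otimes> \<rho> (y \<otimes> x)) \<oplus> (\<Oplus>\<rho>\<in>S. (\<ominus> \<tau> y) \<otimes> (c \<rho> \<otimes> \<rho> x))"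
        using c cl y x by (intro finsum_addf) auto
      also have "(\<Oplus>\<rho>\<in>S. (\<ominus> \<tau> y) \<otimes> (c \<rho> \<otimes> \<rho> x)) = (\<ominus> \<tau> y) \<otimes> (\<Oplus>\<rho>\<in>S. c \<rho> \<otimes> \<rho> x)"
        using c cl y x insert.hyps by (intro finsum_rdistr[symmetric]) auto
      also have "\<dots> = \<tau> y \<otimes> (c \<tau> \<otimes> \<tau> x)"
        using split[OF x] c cl y x by (simp add: l_minus r_minus)
      also have "(\<Oplus>\<rho>\<in>S. c \<rho> \<otimes> \<rho> (y \<otimes> x)) = \<ominus> (c \<tau> \<otimes> (\<tau> y \<otimes> \<tau> x))"
        using split[of "y \<otimes> x"] ring_hom_mult[OF hom, of \<tau> y x] y x by simp
      also have "\<ominus> (c \<tau> \<otimes> (\<tau> y \<otimes> \<tau> x)) \<oplus> \<tau> y \<otimes> (c \<tau> \<otimes> \<tau> x) = \<zero>"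
        using c cl y x by (simp add: m_lcomm l_neg)
      finally show ?thesis .
    qed
    then have "\<forall>\<rho>\<in>S. d \<rho> = \<zero>"
      using insert.prems c cl y by (intro insert.IH) (auto simp: d_def)
    then have "c \<sigma> = \<zero> \<or> \<sigma> y \<ominus> \<tau> y = \<zero>"
      using \<sigma> c[of \<sigma>] cl[of \<sigma> y] cl[of \<tau> y] y by (intro integral) (auto simp: d_def)
    then show ?thesis using y \<sigma> cl by simp
  qed
  then have "(\<Oplus>\<sigma>\<in>S. c \<sigma> \<otimes> \<sigma> \<one>) = \<zero>"
    using cl by (intro add.finprod_one_eqI) auto
  \<comment> \<open>At \<open>x = \<one>\<close> only the term of \<open>\<tau>\<close> is left, and
    it equals \<open>c \<tau>\<close>.\<close>
  then have "c \<tau> = \<zero>"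
    using split[of \<one>] c[of \<tau>] ring_hom_one[OF hom, of \<tau>] by (metis insertI1 minus_minus minus_zero one_closed r_one)
  with zero show ?case by auto
qed

text \<open>Bases are lists and their linear combinations are values of \<open>combine\<close>,
  while linear systems are indexed sums; Artin's bound passes between the two.\<close>

lemma (in ring) combine_eq_finsum:
  assumes "length Ks = length Us" "set Ks \<subseteq> carrier R" "set Us \<subseteq> carrier R"
  shows "combine Ks Us = (\<Oplus>i\<in>{..<length Us}. Ks ! i \<otimes> Us ! i)"
  using assms
proof (induction Ks Us rule: list_induct2)
  case Nil
  then show ?case by simp
next
  case (Cons k Ks u Us)
  have cl: "Ks ! i \<otimes> Us ! i \<in> carrier R" if "i < length Us" for i
    using Cons that by (auto simp: subset_eq)
  have "(\<Oplus>i\<in>{..<length (u # Us)}. (k # Ks) ! i \<otimes> (u # Us) ! i)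
      = (\<Oplus>i\<in>insert 0 (Suc ` {..<length Us}). (k # Ks) ! i \<otimes> (u # Us) ! i)"
    by (simp add: lessThan_Suc_eq_insert_0)
  also have "\<dots> = k \<otimes> u \<oplus> (\<Oplus>i\<in>Suc ` {..<length Us}. (k # Ks) ! i \<otimes> (u # Us) ! i)"
    using Cons cl by (subst finsum_insert) auto
  also have "(\<Oplus>i\<in>Suc ` {..<length Us}. (k # Ks) ! i \<otimes> (u # Us) ! i)
      = (\<Oplus>i\<in>{..<length Us}. Ks ! i \<otimes> Us ! i)"
    using cl by (subst finsum_reindex) auto
  finally show ?case using Cons by simp
qed

section \<open>Algebras over a field\<close>

lemma scalars_hom:
  assumes "algebra F A"
  shows "(\<lambda>k. k \<odot>\<^bsub>A\<^esub> \<one>\<^bsub>A\<^esub>) \<in> ring_hom F A"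
proof -
  interpret algebra F A by fact
  show ?thesis
    by (rule ring_hom_memI) (auto simp: smult_l_distr smult_assoc1 smult_assoc2)
qed

lemma scalars_mult:
  assumes "algebra F A" "k \<in> carrier F" "x \<in> carrier A"
  shows "(k \<odot>\<^bsub>A\<^esub> \<one>\<^bsub>A\<^esub>) \<otimes>\<^bsub>A\<^esub> x = k \<odot>\<^bsub>A\<^esub> x"
proof -
  interpret algebra F A by fact
  show ?thesis using assms by (simp add: smult_assoc2)
qed

text \<open>A ring homomorphism from a field to a nonzero ring is injective with a field as image.
  This opens the dimension theory over subfields to \<open>F\<close>-algebras.\<close>

lemma scalars_subfield:
  assumes "field F" "algebra F A" "\<one>\<^bsub>A\<^esub> \<noteq> \<zero>\<^bsub>A\<^esub>"
  shows "inj_on (\<lambda>k. k \<odot>\<^bsub>A\<^esub> \<one>\<^bsub>A\<^esub>) (carrier F)" "subfield (scalars F A) A"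
proof -
  interpret F: field F by fact
  interpret algebra F A by fact
  interpret h: ring_hom_ring F A "\<lambda>k. k \<odot>\<^bsub>A\<^esub> \<one>\<^bsub>A\<^esub>"
    by (rule ring_hom_ringI2) (auto intro: scalars_hom assms F.ring_axioms ring_axioms)
  show "inj_on (\<lambda>k. k \<odot>\<^bsub>A\<^esub> \<one>\<^bsub>A\<^esub>) (carrier F)" "subfield (scalars F A) A"
    using h.img_is_subfield[OF F.carrier_is_subfield] assms(3) by (auto simp: scalars_def)
qed

text \<open>Dimension is built up by line extensions; written with scalars from \<open>F\<close>,
  such a step no longer depends on where the copy of \<open>F\<close> sits.\<close>

lemma line_extension_scalars:
  assumes "algebra F A" "v \<in> carrier A"
  shows "ring.line_extension A (scalars F A) v E
    = {k \<odot>\<^bsub>A\<^esub> v \<oplus>\<^bsub>A\<^esub> w | k w. k \<in> carrier F \<and> w \<in> E}"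
proof -
  interpret algebra F A by fact
  show ?thesis
    using scalars_mult[OF assms(1) _ assms(2)]
    by (auto simp: line_extension_mem_iff scalars_def) blast+
qed

text \<open>\<open>F\<close> has a different copy inside each algebra, so a dimension can be moved
  between algebras only along a map. Linearity and injectivity are required on the subspace alone,
  and nothing is asked about products or units: this admits the identity between \<open>eA\<close>
  inside \<open>A\<close> and \<open>eA\<close> as an algebra, whose units differ. The proof carries
  line extensions to line extensions.\<close>

lemma dimension_linear_image:
  assumes "field F" "algebra F A" "\<one>\<^bsub>A\<^esub> \<noteq> \<zero>\<^bsub>A\<^esub>" "algebra F B"
    and "ring.dimension A n (scalars F A) E"
    and "f \<in> E \<rightarrow> carrier B" "inj_on f E"
    and "\<And>x y. x \<in> E \<Longrightarrow> y \<in> E \<Longrightarrow> f (x \<oplus>\<^bsub>A\<^esub> y) = f x \<oplus>\<^bsub>B\<^esub> f y"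
    and "\<And>k x. k \<in> carrier F \<Longrightarrow> x \<in> E \<Longrightarrow> f (k \<odot>\<^bsub>A\<^esub> x) = k \<odot>\<^bsub>B\<^esub> f x"
  shows "ring.dimension B n (scalars F B) (f ` E)"
proof -
  interpret A: algebra F A by fact
  interpret B: algebra F B by fact
  note K = scalars_subfield(2)[OF assms(1-3)]
  show ?thesis
    using assms(5-9)
  proof (induction n "scalars F A" E rule: A.dimension.induct)
    case zero_dim
    \<comment> \<open>Additivity alone makes the image of zero neutral, by cancellation.\<close>
    have "f \<zero>\<^bsub>A\<^esub> \<oplus>\<^bsub>B\<^esub> f \<zero>\<^bsub>A\<^esub> = f \<zero>\<^bsub>A\<^esub>" "f \<zero>\<^bsub>A\<^esub> \<in> carrier B"
      using zero_dim by auto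
    then have "f \<zero>\<^bsub>A\<^esub> = \<zero>\<^bsub>B\<^esub>"
      by (metis B.M.add.l_cancel_one')
    then show ?case by auto
  next
    case (Suc_dim v E n)
    let ?E = "A.line_extension (scalars F A) v E"
    have E: "E \<subseteq> carrier A" "\<zero>\<^bsub>A\<^esub> \<in> E"
      using A.space_subgroup_props[OF K Suc_dim.hyps(3)] by auto
    have E': "?E = {k \<odot>\<^bsub>A\<^esub> v \<oplus>\<^bsub>A\<^esub> w | k w. k \<in> carrier F \<and> w \<in> E}"
      using line_extension_scalars[OF assms(2) Suc_dim.hyps(1)] .
    have memE: "k \<odot>\<^bsub>A\<^esub> v \<oplus>\<^bsub>A\<^esub> w \<in> ?E" if "k \<in> carrier F" "w \<in> E" for k w
      using that unfolding E' by auto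
    have EE: "E \<subseteq> ?E"
    proof
      fix w assume w: "w \<in> E"
      then show "w \<in> ?E"
        using memE[of "\<zero>\<^bsub>F\<^esub>" w] E Suc_dim.hyps(1) by auto
    qed
    have kv: "k \<odot>\<^bsub>A\<^esub> v \<in> ?E" if "k \<in> carrier F" for k
      using memE[of k "\<zero>\<^bsub>A\<^esub>"] E Suc_dim.hyps(1) that by auto
    have v: "v \<in> ?E"
      using kv[of "\<one>\<^bsub>F\<^esub>"] Suc_dim.hyps(1) by auto
    have "B.dimension n (scalars F B) (f ` E)"
      using EE Suc_dim.prems by (intro Suc_dim.hyps) (auto intro: inj_on_subset simp: subset_eq)
    moreover have "f v \<notin> f ` E"
      using Suc_dim.prems(2) EE v Suc_dim.hyps(2) by (auto simp: inj_on_def)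
    moreover have "f v \<in> carrier B"
      using Suc_dim.prems(1) v by auto
    ultimately have "B.dimension (Suc n) (scalars F B) (B.line_extension (scalars F B) (f v) (f ` E))"
      by (intro B.Suc_dim)
    moreover have "B.line_extension (scalars F B) (f v) (f ` E) = f ` ?E"
    proof -
      have *: "f (k \<odot>\<^bsub>A\<^esub> v \<oplus>\<^bsub>A\<^esub> w) = k \<odot>\<^bsub>B\<^esub> f v \<oplus>\<^bsub>B\<^esub> f w" if "k \<in> carrier F" "w \<in> E" for k w
        using that Suc_dim.prems(3)[OF kv, of k w] Suc_dim.prems(4)[of k v] v EE by auto
      show ?thesis
        unfolding line_extension_scalars[OF assms(4) \<open>f v \<in> carrier B\<close>] E'
        using * by (auto simp: image_iff) (metis (no_types, lifting))+
    qed
    ultimately show ?case by simp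
  qed
qed

text \<open>The characteristic is an additive order, so this is the criterion for a multiple of an
  element to vanish. Order \<open>0\<close> takes care of characteristic zero.\<close>

lemma characteristic_dvd_iff:
  assumes "ring F"
  shows "characteristic F dvd n \<longleftrightarrow> add_pow F n \<one>\<^bsub>F\<^esub> = \<zero>\<^bsub>F\<^esub>"
proof -
  interpret F: ring F by fact
  show ?thesis
    using F.add.pow_eq_id[of "\<one>\<^bsub>F\<^esub>" n] by (simp add: characteristic_def)
qed

lemma add_pow_one_smult:
  assumes "algebra F A"
  shows "add_pow A (n::nat) \<one>\<^bsub>A\<^esub> = add_pow F n \<one>\<^bsub>F\<^esub> \<odot>\<^bsub>A\<^esub> \<one>\<^bsub>A\<^esub>"
proof -
  interpret A: algebra F A by fact
  show ?thesis
    by (induction n) (simp_all add: A.smult_l_distr)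
qed

lemma alg_homD:
  assumes "f \<in> alg_hom F A B"
  shows "f \<in> ring_hom A B"
    and "x \<in> carrier A \<Longrightarrow> f x \<in> carrier B"
    and "\<lbrakk>x \<in> carrier A; y \<in> carrier A\<rbrakk> \<Longrightarrow> f (x \<otimes>\<^bsub>A\<^esub> y) = f x \<otimes>\<^bsub>B\<^esub> f y"
    and "\<lbrakk>x \<in> carrier A; y \<in> carrier A\<rbrakk> \<Longrightarrow> f (x \<oplus>\<^bsub>A\<^esub> y) = f x \<oplus>\<^bsub>B\<^esub> f y"
    and "f \<one>\<^bsub>A\<^esub> = \<one>\<^bsub>B\<^esub>"
    and "\<lbrakk>k \<in> carrier F; x \<in> carrier A\<rbrakk> \<Longrightarrow> f (k \<odot>\<^bsub>A\<^esub> x) = k \<odot>\<^bsub>B\<^esub> f x"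
  using assms by (auto simp: alg_hom_def dest: ring_hom_closed ring_hom_mult ring_hom_add ring_hom_one)

lemma alg_homI:
  assumes "\<And>x. x \<in> carrier A \<Longrightarrow> f x \<in> carrier B"
    and "\<And>x y. \<lbrakk>x \<in> carrier A; y \<in> carrier A\<rbrakk> \<Longrightarrow> f (x \<otimes>\<^bsub>A\<^esub> y) = f x \<otimes>\<^bsub>B\<^esub> f y"
    and "\<And>x y. \<lbrakk>x \<in> carrier A; y \<in> carrier A\<rbrakk> \<Longrightarrow> f (x \<oplus>\<^bsub>A\<^esub> y) = f x \<oplus>\<^bsub>B\<^esub> f y"
    and "f \<one>\<^bsub>A\<^esub> = \<one>\<^bsub>B\<^esub>"
    and "\<And>k x. \<lbrakk>k \<in> carrier F; x \<in> carrier A\<rbrakk> \<Longrightarrow> f (k \<odot>\<^bsub>A\<^esub> x) = k \<odot>\<^bsub>B\<^esub> f x"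
  shows "f \<in> alg_hom F A B"
  using assms by (auto simp: alg_hom_def intro!: ring_hom_memI)

lemma Aut_alg_carrier: "carrier (Aut_alg F A) = alg_hom F A A \<inter> Bij (carrier A)"
  by (simp add: Aut_alg_def)

lemma Aut_alg_mult:
  "\<lbrakk>\<sigma> \<in> carrier (Aut_alg F A); \<tau> \<in> carrier (Aut_alg F A)\<rbrakk>
    \<Longrightarrow> \<sigma> \<otimes>\<^bsub>Aut_alg F A\<^esub> \<tau> = compose (carrier A) \<sigma> \<tau>"
  by (simp add: Aut_alg_def BijGroup_def)

text \<open>Dedekind's bound. With more automorphisms than basis elements, some nontrivial
  combination of the automorphisms vanishes on the basis, hence everywhere by linearity, against the
  independence of characters.\<close>

lemma card_Aut_alg_le_dimension:
  assumes "field F" "algebra F L" "field L"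
    and "ring.dimension L n (scalars F L) (carrier L)"
  shows "finite (carrier (Aut_alg F L))" "card (carrier (Aut_alg F L)) \<le> n"
proof -
  interpret L: field L by fact
  interpret LA: algebra F L by fact
  note K = scalars_subfield(2)[OF assms(1,2) L.one_not_zero]
  \<comment> \<open>The bound is proved for finite subsets because \<open>card\<close> of an
    infinite set is 0. A uniform bound on all finite subsets then yields finiteness as well.\<close>
  have le: "card S \<le> n" if S: "S \<subseteq> carrier (Aut_alg F L)" "finite S" for S
  proof (rule ccontr)
    assume "\<not> card S \<le> n"
    obtain Us where Us: "set Us \<subseteq> carrier L" "length Us = n"
      "L.Span (scalars F L) Us = carrier L"
      using L.exists_base[OF K assms(4)] by auto
    have hom: "\<sigma> \<in> alg_hom F L L" if "\<sigma> \<in> S" for \<sigma>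
      using that S by (auto simp: Aut_alg_carrier)
    note hom_simps = alg_homD[OF hom]
    have "\<exists>x \<in> S \<rightarrow> carrier L. (\<exists>\<sigma>\<in>S. x \<sigma> \<noteq> \<zero>\<^bsub>L\<^esub>) \<and>
        (\<forall>i\<in>{..<n}. (\<Oplus>\<^bsub>L\<^esub>\<sigma>\<in>S. \<sigma> (Us ! i) \<otimes>\<^bsub>L\<^esub> x \<sigma>) = \<zero>\<^bsub>L\<^esub>)"
      using S Us \<open>\<not> card S \<le> n\<close> hom_simps(2)
      by (intro L.homogeneous_system_nontrivial_solution) (auto simp: subset_eq)
    then obtain c where c: "c \<in> S \<rightarrow> carrier L" "\<exists>\<sigma>\<in>S. c \<sigma> \<noteq> \<zero>\<^bsub>L\<^esub>"
      "\<And>i. i < n \<Longrightarrow> (\<Oplus>\<^bsub>L\<^esub>\<sigma>\<in>S. \<sigma> (Us ! i) \<otimes>\<^bsub>L\<^esub> c \<sigma>) = \<zero>\<^bsub>L\<^esub>"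
      by blast
    \<comment> \<open>\<open>T\<close> is linear over \<open>F\<close>, though not over
      \<open>L\<close>, so it is enough that it vanishes on the spanning list
      \<open>Us\<close>.\<close>
    define T where "T x = (\<Oplus>\<^bsub>L\<^esub>\<sigma>\<in>S. c \<sigma> \<otimes>\<^bsub>L\<^esub> \<sigma> x)" for x
    have cl: "c \<sigma> \<otimes>\<^bsub>L\<^esub> \<sigma> x \<in> carrier L" if "\<sigma> \<in> S" "x \<in> carrier L" for \<sigma> x
      using that c(1) hom_simps(2) by auto
    have T_add: "T (x \<oplus>\<^bsub>L\<^esub> y) = T x \<oplus>\<^bsub>L\<^esub> T y" if "x \<in> carrier L" "y \<in> carrier L" for x y
    proof -
      have "T (x \<oplus>\<^bsub>L\<^esub> y) = (\<Oplus>\<^bsub>L\<^esub>\<sigma>\<in>S. c \<sigma> \<otimes>\<^bsub>L\<^esub> \<sigma> x \<oplus>\<^bsub>L\<^esub> c \<sigma> \<otimes>\<^bsub>L\<^esub> \<sigma> y)"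
        unfolding T_def
      proof (intro L.finsum_cong')
        fix \<sigma> assume \<sigma>: "\<sigma> \<in> S"
        then show "c \<sigma> \<otimes>\<^bsub>L\<^esub> \<sigma> (x \<oplus>\<^bsub>L\<^esub> y) = c \<sigma> \<otimes>\<^bsub>L\<^esub> \<sigma> x \<oplus>\<^bsub>L\<^esub> c \<sigma> \<otimes>\<^bsub>L\<^esub> \<sigma> y"
          using that c(1) hom_simps(2,4)[OF \<sigma>] by (auto intro: L.r_distr)
      qed (use cl that in auto)
      then show ?thesis
        unfolding T_def using cl that by (simp add: L.finsum_addf Pi_def)
    qed
    have T_smult: "T (k \<odot>\<^bsub>L\<^esub> x) = k \<odot>\<^bsub>L\<^esub> T x" if "k \<in> carrier F" "x \<in> carrier L" for k x
    proof -
      have k: "k \<odot>\<^bsub>L\<^esub> \<one>\<^bsub>L\<^esub> \<in> carrier L" using that by auto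
      have "T (k \<odot>\<^bsub>L\<^esub> x) = (\<Oplus>\<^bsub>L\<^esub>\<sigma>\<in>S. (k \<odot>\<^bsub>L\<^esub> \<one>\<^bsub>L\<^esub>) \<otimes>\<^bsub>L\<^esub> (c \<sigma> \<otimes>\<^bsub>L\<^esub> \<sigma> x))"
        unfolding T_def
      proof (intro L.finsum_cong')
        fix \<sigma> assume \<sigma>: "\<sigma> \<in> S"
        have "\<sigma> (k \<odot>\<^bsub>L\<^esub> x) = (k \<odot>\<^bsub>L\<^esub> \<one>\<^bsub>L\<^esub>) \<otimes>\<^bsub>L\<^esub> \<sigma> x"
          using that \<sigma> hom_simps(2,6)[OF \<sigma>] by (simp add: scalars_mult[OF assms(2)])
        then show "c \<sigma> \<otimes>\<^bsub>L\<^esub> \<sigma> (k \<odot>\<^bsub>L\<^esub> x) = (k \<odot>\<^bsub>L\<^esub> \<one>\<^bsub>L\<^esub>) \<otimes>\<^bsub>L\<^esub> (c \<sigma> \<otimes>\<^bsub>L\<^esub> \<sigma> x)"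
          using \<sigma> c(1) k hom_simps(2)[OF \<sigma> that(2)] by (simp add: L.m_lcomm Pi_def)
      qed (use k cl that in auto)
      also have "\<dots> = (k \<odot>\<^bsub>L\<^esub> \<one>\<^bsub>L\<^esub>) \<otimes>\<^bsub>L\<^esub> T x"
        unfolding T_def using S k cl that by (intro L.finsum_rdistr[symmetric]) auto
      finally show ?thesis
        unfolding T_def using that cl
        by (simp add: scalars_mult[OF assms(2)] L.finsum_closed Pi_def)
    qed
    have T_Us: "T u = \<zero>\<^bsub>L\<^esub>" if u: "u \<in> set Us" for u
    proof -
      have uL: "u \<in> carrier L" using u Us(1) by auto
      obtain i where i: "i < n" "u = Us ! i"
        using u Us(2) by (metis in_set_conv_nth)
      have "T u = (\<Oplus>\<^bsub>L\<^esub>\<sigma>\<in>S. \<sigma> (Us ! i) \<otimes>\<^bsub>L\<^esub> c \<sigma>)"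
        unfolding T_def i(2) using c(1) hom_simps(2)[OF _ uL] i
        by (intro L.finsum_cong') (auto simp: Pi_def L.m_comm)
      then show ?thesis using c(3)[OF i(1)] by simp
    qed
    have "T (L.combine Ks Vs) = \<zero>\<^bsub>L\<^esub>" if "set Ks \<subseteq> scalars F L" "set Vs \<subseteq> set Us" for Ks Vs
      using that
    proof (induction Ks Vs rule: L.combine.induct)
      case (1 k Ks u Vs)
      obtain l where l: "l \<in> carrier F" "k = l \<odot>\<^bsub>L\<^esub> \<one>\<^bsub>L\<^esub>"
        using 1(2) by (auto simp: scalars_def)
      have u: "u \<in> carrier L" using 1 Us by auto
      have "L.combine Ks Vs \<in> carrier L"
        using 1 Us L.subring_props(1)[OF K] by (intro L.combine_in_carrier) auto
      moreover have "T (L.combine Ks Vs) = \<zero>\<^bsub>L\<^esub>" using 1 by auto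
      moreover have "T u = \<zero>\<^bsub>L\<^esub>" using 1 T_Us by auto
      moreover have "k \<otimes>\<^bsub>L\<^esub> u = l \<odot>\<^bsub>L\<^esub> u"
        using l u by (simp add: scalars_mult[OF assms(2)])
      ultimately show ?case
        using T_add[of "l \<odot>\<^bsub>L\<^esub> u"] T_smult[OF l(1) u] l(1) u by simp
    next
      case ("2_1" Us)
      then show ?case
        using T_smult[of "\<zero>\<^bsub>F\<^esub>" "\<zero>\<^bsub>L\<^esub>"] cl unfolding T_def
        by (simp add: L.finsum_closed Pi_def)
    next
      case ("2_2" Ks)
      then show ?case
        using T_smult[of "\<zero>\<^bsub>F\<^esub>" "\<zero>\<^bsub>L\<^esub>"] cl unfolding T_def
        by (simp add: L.finsum_closed Pi_def)
    qed
    then have "T x = \<zero>\<^bsub>L\<^esub>" if "x \<in> carrier L" for x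
      using that Us(3) L.Span_eq_combine_set[OF K Us(1)] by auto
    then have "\<forall>\<sigma>\<in>S. c \<sigma> = \<zero>\<^bsub>L\<^esub>"
      using S c(1) hom_simps(1) unfolding T_def
      by (intro L.independence_of_characters) (auto simp: Aut_alg_carrier Bij_def)
    with c(2) show False by auto
  qed
  show "finite (carrier (Aut_alg F L))"
    using le finite_if_finite_subsets_card_bdd by blast
  with le show "card (carrier (Aut_alg F L)) \<le> n" by auto
qed

section \<open>Group actions by algebra automorphisms\<close>

text \<open>Only what is available before any Galois property is established. It is interpreted for
  \<open>G\<close> on \<open>A\<close>, for the stabilizer on \<open>eA\<close>, and for
  \<open>G\<close> on the induced algebra.\<close>

locale algebra_action = group G + A: algebra F A
  for G :: "('g, 'p) monoid_scheme" (structure)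
    and F :: "('f, 'k) ring_scheme"
    and A :: "('f, 'a, 'm) module_scheme"
    and \<phi> :: "'g \<Rightarrow> 'a \<Rightarrow> 'a" +
  assumes hom_Aut: "\<phi> \<in> hom G (Aut_alg F A)"
begin

lemma act_Aut: "g \<in> carrier G \<Longrightarrow> \<phi> g \<in> carrier (Aut_alg F A)"
  using hom_Aut by (auto simp: hom_def)

lemma act_alg_hom: "g \<in> carrier G \<Longrightarrow> \<phi> g \<in> alg_hom F A A"
  using act_Aut by (auto simp: Aut_alg_carrier)

lemma act_closed [simp, intro]:
  "\<lbrakk>g \<in> carrier G; x \<in> carrier A\<rbrakk> \<Longrightarrow> \<phi> g x \<in> carrier A"
  using alg_homD(2)[OF act_alg_hom] .

lemma act_mult:
  "\<lbrakk>g \<in> carrier G; x \<in> carrier A; y \<in> carrier A\<rbrakk> \<Longrightarrow> \<phi> g (x \<otimes>\<^bsub>A\<^esub> y) = \<phi> g x \<otimes>\<^bsub>A\<^esub> \<phi> g y"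
  using alg_homD(3)[OF act_alg_hom] .

lemma act_add:
  "\<lbrakk>g \<in> carrier G; x \<in> carrier A; y \<in> carrier A\<rbrakk> \<Longrightarrow> \<phi> g (x \<oplus>\<^bsub>A\<^esub> y) = \<phi> g x \<oplus>\<^bsub>A\<^esub> \<phi> g y"
  using alg_homD(4)[OF act_alg_hom] .

lemma act_one [simp]: "g \<in> carrier G \<Longrightarrow> \<phi> g \<one>\<^bsub>A\<^esub> = \<one>\<^bsub>A\<^esub>"
  using alg_homD(5)[OF act_alg_hom] .

lemma act_smult:
  "\<lbrakk>g \<in> carrier G; k \<in> carrier F; x \<in> carrier A\<rbrakk> \<Longrightarrow> \<phi> g (k \<odot>\<^bsub>A\<^esub> x) = k \<odot>\<^bsub>A\<^esub> \<phi> g x"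
  using alg_homD(6)[OF act_alg_hom] .

lemma act_zero [simp]: "g \<in> carrier G \<Longrightarrow> \<phi> g \<zero>\<^bsub>A\<^esub> = \<zero>\<^bsub>A\<^esub>"
  using act_smult[of g "\<zero>\<^bsub>F\<^esub>" "\<zero>\<^bsub>A\<^esub>"] by simp

lemma act_act:
  "\<lbrakk>g \<in> carrier G; h \<in> carrier G; x \<in> carrier A\<rbrakk> \<Longrightarrow> \<phi> g (\<phi> h x) = \<phi> (g \<otimes> h) x"
  using hom_Aut act_Aut by (simp add: hom_def Aut_alg_mult compose_def)

lemma act_inj: "g \<in> carrier G \<Longrightarrow> inj_on (\<phi> g) (carrier A)"
  using act_Aut by (auto simp: Aut_alg_carrier Bij_def bij_betw_def)

lemma act_one_group [simp]: "x \<in> carrier A \<Longrightarrow> \<phi> \<one> x = x"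
  using act_act[of \<one> \<one> x] act_inj[of \<one>] by (auto simp: inj_on_def)

lemma act_inv_act [simp]:
  assumes "g \<in> carrier G" "x \<in> carrier A"
  shows "\<phi> (inv g) (\<phi> g x) = x" "\<phi> g (\<phi> (inv g) x) = x"
  using assms by (simp_all add: act_act)

lemma act_finsum:
  assumes "g \<in> carrier G" "f \<in> I \<rightarrow> carrier A"
  shows "\<phi> g (\<Oplus>\<^bsub>A\<^esub>i\<in>I. f i) = (\<Oplus>\<^bsub>A\<^esub>i\<in>I. \<phi> g (f i))"
  using assms(2)
proof (induction I rule: infinite_finite_induct)
  case (infinite I)
  then show ?case using assms(1) by (simp add: A.finsum_infinite)
next
  case empty
  then show ?case using assms(1) by simp
next
  case (insert i I)
  then have "f \<in> I \<rightarrow> carrier A" "f i \<in> carrier A" by auto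
  with insert assms(1) show ?case
    by (simp add: act_add A.finsum_insert A.finsum_closed Pi_def)
qed

text \<open>Forgetting the algebra structure gives access to stabilizers and the orbit-stabilizer
  theorem.\<close>

lemma is_group_action: "group_action G (carrier A) \<phi>"
proof -
  have "\<phi> \<in> hom G (BijGroup (carrier A))"
    using hom_Aut by (auto simp: hom_def Aut_alg_def BijGroup_def)
  then show ?thesis
    by (auto simp: group_action_def group_hom_def group_hom_axioms_def group_BijGroup is_group)
qed

text \<open>Artin's bound by averaging: if \<open>z\<close> solves the system with coefficients \<open>\<sigma> (u\<^sub>j)\<close>, then so
  does the vector of traces of its coordinates, which are scalars.  The hypothesis on the
  characteristic makes the trace of a coordinate \<open>1\<close> nonzero.\<close>
lemma dimension_le_card_image:
  assumes "field F" "field A" "finite (carrier G)"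
    and inv: "\<And>a. \<lbrakk>a \<in> carrier A; \<forall>g\<in>carrier G. \<phi> g a = a\<rbrakk> \<Longrightarrow> a \<in> scalars F A"
    and "\<not> characteristic F dvd order G"
    and "ring.dimension A n (scalars F A) (carrier A)"
  shows "n \<le> card (\<phi> ` carrier G)"
proof (rule ccontr)
  interpret A: field A by fact
  interpret F: field F by fact
  note alg = A.algebra_axioms
  note K = scalars_subfield(2)[OF assms(1) alg A.one_not_zero]
  assume less: "\<not> n \<le> card (\<phi> ` carrier G)"
  obtain Us where Us: "set Us \<subseteq> carrier A" "length Us = n" "A.independent (scalars F A) Us"
    using A.exists_base[OF K assms(6)] by auto
  have U: "Us ! i \<in> carrier A" if "i < n" for i
    using that Us by auto
  \<comment> \<open>There is one equation for each distinct map, not for each group element. The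
    resulting bound therefore counts the image of \<open>\<phi>\<close>, and this is what later
    detects injectivity.\<close>
  have "\<exists>x \<in> {..<n} \<rightarrow> carrier A. (\<exists>i\<in>{..<n}. x i \<noteq> \<zero>\<^bsub>A\<^esub>) \<and>
      (\<forall>\<sigma>\<in>\<phi> ` carrier G. (\<Oplus>\<^bsub>A\<^esub>i\<in>{..<n}. \<sigma> (Us ! i) \<otimes>\<^bsub>A\<^esub> x i) = \<zero>\<^bsub>A\<^esub>)"
    using assms(3) less U by (intro A.homogeneous_system_nontrivial_solution) auto
  then obtain x i0 where x: "x \<in> {..<n} \<rightarrow> carrier A" "i0 < n" "x i0 \<noteq> \<zero>\<^bsub>A\<^esub>"
    "\<And>g. g \<in> carrier G \<Longrightarrow> (\<Oplus>\<^bsub>A\<^esub>i\<in>{..<n}. \<phi> g (Us ! i) \<otimes>\<^bsub>A\<^esub> x i) = \<zero>\<^bsub>A\<^esub>"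
    by auto
  \<comment> \<open>Dividing by a nonzero coordinate makes coordinate \<open>i0\<close> of
    \<open>z\<close> equal to 1, so that its trace is |G| times 1.\<close>
  define y where "y = inv\<^bsub>A\<^esub> (x i0)"
  have "x i0 \<in> Units A"
    using x(1-3) A.field_Units by auto
  then have y: "y \<in> carrier A" "x i0 \<otimes>\<^bsub>A\<^esub> y = \<one>\<^bsub>A\<^esub>"
    using \<open>x i0 \<in> Units A\<close> A.Units_inv_closed A.Units_r_inv by (auto simp: y_def)
  define z where "z i = x i \<otimes>\<^bsub>A\<^esub> y" for i
  have z: "z i \<in> carrier A" if "i < n" for i
    using that x y by (auto simp: z_def)
  have z_eq: "(\<Oplus>\<^bsub>A\<^esub>i\<in>{..<n}. \<phi> g (Us ! i) \<otimes>\<^bsub>A\<^esub> z i) = \<zero>\<^bsub>A\<^esub>" if g: "g \<in> carrier G" for g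
  proof -
    have "(\<Oplus>\<^bsub>A\<^esub>i\<in>{..<n}. \<phi> g (Us ! i) \<otimes>\<^bsub>A\<^esub> z i)
        = (\<Oplus>\<^bsub>A\<^esub>i\<in>{..<n}. (\<phi> g (Us ! i) \<otimes>\<^bsub>A\<^esub> x i) \<otimes>\<^bsub>A\<^esub> y)"
      using g U x y by (intro A.finsum_cong') (auto simp: z_def A.m_assoc Pi_def)
    also have "\<dots> = \<zero>\<^bsub>A\<^esub> \<otimes>\<^bsub>A\<^esub> y"
      unfolding x(4)[OF g, symmetric] using g U x y by (intro A.finsum_ldistr[symmetric]) auto
    finally show ?thesis using y by simp
  qed
  define t where "t i = (\<Oplus>\<^bsub>A\<^esub>h\<in>carrier G. \<phi> h (z i))" for i
  have t: "t i \<in> carrier A" if "i < n" for i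
    unfolding t_def using that z by (intro A.finsum_closed) auto
  have tK: "t i \<in> scalars F A" if i: "i < n" for i
  proof (rule inv[OF t[OF i]], rule ballI)
    fix g assume g: "g \<in> carrier G"
    have "\<phi> g (t i) = (\<Oplus>\<^bsub>A\<^esub>h\<in>carrier G. \<phi> (g \<otimes> h) (z i))"
      unfolding t_def using g z[OF i]
      by (subst act_finsum) (auto simp: act_act intro!: A.finsum_cong')
    also have "\<dots> = (\<Oplus>\<^bsub>A\<^esub>h\<in>(\<otimes>) g ` carrier G. \<phi> h (z i))"
      using g z[OF i] by (subst A.finsum_reindex) (auto intro: inj_on_cmult)
    also have "(\<otimes>) g ` carrier G = carrier G"
      using surj_const_mult[OF g] .
    finally show "\<phi> g (t i) = t i" by (simp add: t_def)
  qed
  have "(\<Oplus>\<^bsub>A\<^esub>i\<in>{..<n}. t i \<otimes>\<^bsub>A\<^esub> Us ! i) = \<zero>\<^bsub>A\<^esub>"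
  proof -
    have "(\<Oplus>\<^bsub>A\<^esub>i\<in>{..<n}. t i \<otimes>\<^bsub>A\<^esub> Us ! i)
        = (\<Oplus>\<^bsub>A\<^esub>i\<in>{..<n}. \<Oplus>\<^bsub>A\<^esub>h\<in>carrier G. \<phi> h (z i) \<otimes>\<^bsub>A\<^esub> Us ! i)"
      unfolding t_def using U z assms(3)
      by (intro A.finsum_cong' A.finsum_ldistr) (auto intro!: A.finsum_closed)
    also have "\<dots> = (\<Oplus>\<^bsub>A\<^esub>h\<in>carrier G. \<Oplus>\<^bsub>A\<^esub>i\<in>{..<n}. \<phi> h (z i) \<otimes>\<^bsub>A\<^esub> Us ! i)"
      using U z assms(3) by (intro A.finsum_swap) auto
    also have "\<dots> = \<zero>\<^bsub>A\<^esub>"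
    proof (rule A.add.finprod_one_eqI)
      fix h assume h: "h \<in> carrier G"
      \<comment> \<open>Each \<open>Us ! i\<close> is \<open>\<phi> h\<close> of its translate by
        \<open>inv h\<close>, so the inner sum is \<open>\<phi> h\<close> applied to the equation of
        \<open>inv h\<close>.\<close>
      have "(\<Oplus>\<^bsub>A\<^esub>i\<in>{..<n}. \<phi> h (z i) \<otimes>\<^bsub>A\<^esub> Us ! i)
          = (\<Oplus>\<^bsub>A\<^esub>i\<in>{..<n}. \<phi> h (\<phi> (inv h) (Us ! i) \<otimes>\<^bsub>A\<^esub> z i))"
        using h U z by (intro A.finsum_cong') (auto simp: act_mult A.m_comm)
      also have "\<dots> = \<phi> h (\<Oplus>\<^bsub>A\<^esub>i\<in>{..<n}. \<phi> (inv h) (Us ! i) \<otimes>\<^bsub>A\<^esub> z i)"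
        using h U z by (intro act_finsum[symmetric]) auto
      also have "\<dots> = \<zero>\<^bsub>A\<^esub>"
        using h z_eq[of "inv h"] by simp
      finally show "(\<Oplus>\<^bsub>A\<^esub>i\<in>{..<n}. \<phi> h (z i) \<otimes>\<^bsub>A\<^esub> Us ! i) = \<zero>\<^bsub>A\<^esub>" .
    qed
    finally show ?thesis .
  qed
  also have "(\<Oplus>\<^bsub>A\<^esub>i\<in>{..<n}. t i \<otimes>\<^bsub>A\<^esub> Us ! i)
      = (\<Oplus>\<^bsub>A\<^esub>i\<in>{..<length Us}. map t [0..<n] ! i \<otimes>\<^bsub>A\<^esub> Us ! i)"
    using U t Us by (intro A.finsum_cong') auto
  also have "\<dots> = A.combine (map t [0..<n]) Us"
    using U t Us by (intro A.combine_eq_finsum[symmetric]) auto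
  finally have "A.combine (map t [0..<n]) Us = \<zero>\<^bsub>A\<^esub>" .
  then have "set (take (length Us) (map t [0..<n])) \<subseteq> {\<zero>\<^bsub>A\<^esub>}"
    using tK by (intro A.independent_imp_trivial_combine[OF K Us(3)]) auto
  then have "t i0 = \<zero>\<^bsub>A\<^esub>"
    using x(2) Us(2) by (auto simp: image_subset_iff)
  moreover have "z i0 = \<one>\<^bsub>A\<^esub>" using y by (simp add: z_def)
  ultimately have "(\<Oplus>\<^bsub>A\<^esub>h\<in>carrier G. \<one>\<^bsub>A\<^esub>) = \<zero>\<^bsub>A\<^esub>"
    by (simp add: t_def cong: A.finsum_cong)
  then have "add_pow F (order G) \<one>\<^bsub>F\<^esub> \<odot>\<^bsub>A\<^esub> \<one>\<^bsub>A\<^esub> = \<zero>\<^bsub>F\<^esub> \<odot>\<^bsub>A\<^esub> \<one>\<^bsub>A\<^esub>"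
    using add_pow_one_smult[OF alg, of "order G"] by (simp add: A.add.finprod_const order_def)
  then have "add_pow F (order G) \<one>\<^bsub>F\<^esub> = \<zero>\<^bsub>F\<^esub>"
    using scalars_subfield(1)[OF assms(1) alg A.one_not_zero] by (auto simp: inj_on_def)
  then show False
    using assms(5) characteristic_dvd_iff[OF cring.axioms(1)[OF A.R_cring]] by simp
qed

end

section \<open>Components of an algebra\<close>

lemma component_simps [simp]:
  "monoid.mult (component A e) = monoid.mult A" "one (component A e) = e"
  "zero (component A e) = zero A" "add (component A e) = add A"
  "smult (component A e) = smult A"
  by (simp_all add: component_def)

lemma component_carrier_iff:
  assumes "cring A" "e \<in> idempotents A"
  shows "x \<in> carrier (component A e) \<longleftrightarrow> x \<in> carrier A \<and> e \<otimes>\<^bsub>A\<^esub> x = x"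
proof -
  interpret A: cring A by fact
  have "e \<in> carrier A" "e \<otimes>\<^bsub>A\<^esub> e = e" using assms(2) by (auto simp: idempotents_def)
  then show ?thesis
    by (auto simp: component_def A.m_assoc[symmetric] image_iff intro: bexI[of _ x])
qed

lemma component_algebra:
  assumes "algebra F A" "e \<in> idempotents A"
  shows "algebra F (component A e)"
proof -
  interpret A: algebra F A by fact
  have e: "e \<in> carrier A" "e \<otimes>\<^bsub>A\<^esub> e = e"
    using assms(2) by (auto simp: idempotents_def)
  note mem = component_carrier_iff[OF A.M_cring assms(2)]
  have zero: "\<zero>\<^bsub>A\<^esub> \<in> carrier (component A e)"
    using e by (simp add: mem)
  have add: "x \<oplus>\<^bsub>A\<^esub> y \<in> carrier (component A e)"
    if "x \<in> carrier (component A e)" "y \<in> carrier (component A e)" for x y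
    using that e by (auto simp: mem A.r_distr)
  have neg: "\<ominus>\<^bsub>A\<^esub> x \<in> carrier (component A e)" if "x \<in> carrier (component A e)" for x
    using that e by (auto simp: mem A.r_minus)
  have smult: "k \<odot>\<^bsub>A\<^esub> x \<in> carrier (component A e)"
    if "k \<in> carrier F" "x \<in> carrier (component A e)" for k x
  proof -
    have "e \<otimes>\<^bsub>A\<^esub> (k \<odot>\<^bsub>A\<^esub> x) = k \<odot>\<^bsub>A\<^esub> (x \<otimes>\<^bsub>A\<^esub> e)"
      using that e A.smult_assoc2[of k x e] A.m_comm[of e "k \<odot>\<^bsub>A\<^esub> x"] by (auto simp: mem)
    then show ?thesis
      using that e A.m_comm[of x e] by (auto simp: mem)
  qed
  have mult: "x \<otimes>\<^bsub>A\<^esub> y \<in> carrier (component A e)"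
    if "x \<in> carrier (component A e)" "y \<in> carrier (component A e)" for x y
    using that e A.m_assoc[of e x y] by (auto simp: mem)
  have sub: "x \<in> carrier A" if "x \<in> carrier (component A e)" for x
    using that by (auto simp: mem)
  have "abelian_group (component A e)"
  proof (rule abelian_groupI)
    fix x assume x: "x \<in> carrier (component A e)"
    then show "\<exists>y\<in>carrier (component A e). y \<oplus>\<^bsub>component A e\<^esub> x = \<zero>\<^bsub>component A e\<^esub>"
      using neg[OF x] sub[OF x] by (auto intro!: bexI[of _ "\<ominus>\<^bsub>A\<^esub> x"] simp: A.l_neg)
  qed (use zero add sub in \<open>auto simp: A.a_ac\<close>)
  moreover have "comm_monoid (component A e)"
  proof (rule comm_monoidI)
    show "\<one>\<^bsub>component A e\<^esub> \<in> carrier (component A e)" using e by (simp add: mem)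
    show "\<one>\<^bsub>component A e\<^esub> \<otimes>\<^bsub>component A e\<^esub> x = x" if "x \<in> carrier (component A e)" for x
      using that by (simp add: mem)
    show "x \<otimes>\<^bsub>component A e\<^esub> y = y \<otimes>\<^bsub>component A e\<^esub> x"
      if "x \<in> carrier (component A e)" "y \<in> carrier (component A e)" for x y
      using sub[OF that(1)] sub[OF that(2)] by (simp add: A.m_comm)
  qed (use mult sub in \<open>auto simp: A.m_assoc\<close>)
  ultimately have "cring (component A e)"
    using sub by (intro cringI) (auto simp: A.l_distr)
  then show ?thesis
    using smult sub
    by (intro algebraI A.R_cring)
       (auto simp: A.smult_l_distr A.smult_r_distr A.smult_assoc1 A.smult_assoc2)
qed

text \<open>Otherwise \<open>e\<close> would be the sum of the orthogonal nonzero idempotents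
  \<open>e \<otimes> u\<close> and \<open>e \<ominus> e \<otimes> u\<close>.\<close>

lemma primitive_idempotent_mult:
  assumes "cring A" "e \<in> primitive_idempotents A" "u \<in> carrier A" "u \<otimes>\<^bsub>A\<^esub> u = u"
  shows "e \<otimes>\<^bsub>A\<^esub> u = \<zero>\<^bsub>A\<^esub> \<or> e \<otimes>\<^bsub>A\<^esub> u = e"
proof (rule ccontr)
  interpret A: cring A by fact
  have e: "e \<in> carrier A" "e \<otimes>\<^bsub>A\<^esub> e = e"
    using assms(2) by (auto simp: primitive_idempotents_def idempotents_def)
  assume "\<not> ?thesis"
  then have ne: "e \<otimes>\<^bsub>A\<^esub> u \<noteq> \<zero>\<^bsub>A\<^esub>" "e \<otimes>\<^bsub>A\<^esub> u \<noteq> e" by auto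
  define p where "p = e \<otimes>\<^bsub>A\<^esub> u"
  define q where "q = e \<ominus>\<^bsub>A\<^esub> p"
  have p: "p \<in> carrier A" "e \<otimes>\<^bsub>A\<^esub> p = p"
    using e assms(3) by (auto simp: p_def A.m_assoc[symmetric])
  have "p \<otimes>\<^bsub>A\<^esub> p = (e \<otimes>\<^bsub>A\<^esub> e) \<otimes>\<^bsub>A\<^esub> (u \<otimes>\<^bsub>A\<^esub> u)"
    using e(1) assms(3) unfolding p_def by algebra
  then have pp: "p \<otimes>\<^bsub>A\<^esub> p = p"
    using e assms(4) by (simp add: p_def)
  have q: "q \<in> carrier A" using e p by (simp add: q_def)
  have pe: "p \<otimes>\<^bsub>A\<^esub> e = p" using p e by (simp add: A.m_comm)
  have pq: "p \<otimes>\<^bsub>A\<^esub> q = \<zero>\<^bsub>A\<^esub>"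
    using e p pe pp by (simp add: q_def A.minus_eq A.r_distr A.r_minus A.r_neg)
  have eq: "e \<otimes>\<^bsub>A\<^esub> q = q"
    using e p by (simp add: q_def A.minus_eq A.r_distr A.r_minus)
  have "q \<otimes>\<^bsub>A\<^esub> q = e \<otimes>\<^bsub>A\<^esub> q \<ominus>\<^bsub>A\<^esub> p \<otimes>\<^bsub>A\<^esub> q"
    using e p q by (subst (1) q_def) (simp add: A.minus_eq A.l_distr A.l_minus)
  then have qq: "q \<otimes>\<^bsub>A\<^esub> q = q"
    using eq pq q by (simp add: A.minus_eq)
  have "q \<noteq> \<zero>\<^bsub>A\<^esub>" using ne(2) e p by (auto simp: q_def p_def)
  moreover have "e = p \<oplus>\<^bsub>A\<^esub> q"
    using e p by (simp add: q_def A.minus_eq A.a_lcomm A.r_neg)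
  moreover have "q \<otimes>\<^bsub>A\<^esub> p = \<zero>\<^bsub>A\<^esub>" using pq p q by (simp add: A.m_comm)
  moreover have "p \<in> idempotents A" "q \<in> idempotents A"
    using p q pp qq ne(1) \<open>q \<noteq> \<zero>\<^bsub>A\<^esub>\<close> by (auto simp: idempotents_def p_def)
  ultimately show False
    using assms(2) pq unfolding primitive_idempotents_def by blast
qed

section \<open>Components of an etale algebra\<close>

lemma field_alg_iso:
  assumes "cring A" "field L" "f \<in> alg_iso F A L"
  shows "field A"
proof -
  interpret A: cring A by fact
  interpret L: field L by fact
  have f: "f \<in> alg_hom F A L" "inj_on f (carrier A)" "f ` carrier A = carrier L"
    using assms(3) by (auto simp: alg_iso_def bij_betw_def)
  note hom = alg_homD[OF f(1)]
  have f0: "f \<zero>\<^bsub>A\<^esub> = \<zero>\<^bsub>L\<^esub>"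
    using ring_hom_zero[OF hom(1) A.ring_axioms L.ring_axioms] .
  have "\<one>\<^bsub>A\<^esub> \<noteq> \<zero>\<^bsub>A\<^esub>"
    using f0 hom(5) L.one_not_zero by auto
  moreover have "x \<in> Units A" if x: "x \<in> carrier A" "x \<noteq> \<zero>\<^bsub>A\<^esub>" for x
  proof -
    have "f x \<noteq> \<zero>\<^bsub>L\<^esub>"
      using x f0 f(2) by (metis A.zero_closed inj_onD)
    then have "f x \<in> Units L"
      using hom(2)[OF x(1)] L.field_Units by auto
    then obtain y where y: "y \<in> carrier L" "f x \<otimes>\<^bsub>L\<^esub> y = \<one>\<^bsub>L\<^esub>"
      using L.Units_r_inv_ex by auto
    then obtain x' where x': "x' \<in> carrier A" "y = f x'"
      using f(3) by auto
    have "f (x \<otimes>\<^bsub>A\<^esub> x') = f \<one>\<^bsub>A\<^esub>"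
      using x x' y hom by auto
    then have "x \<otimes>\<^bsub>A\<^esub> x' = \<one>\<^bsub>A\<^esub>"
      using f(2) x x' by (auto dest: inj_onD)
    then show ?thesis
      using x x' A.m_comm[of x x'] by (auto simp: Units_def)
  qed
  ultimately have "Units A = carrier A - {\<zero>\<^bsub>A\<^esub>}"
    by (auto simp: Units_def)
  then show ?thesis by (rule A.cring_fieldI)
qed

text \<open>An algebra isomorphism from \<open>A\<close> to a product of fields sends a primitive idempotent to a
  vector with a single nonzero coordinate; the projection to that coordinate is the isomorphism.\<close>
lemma primitive_component_alg_iso:
  fixes A :: "('f, 'a, 'm) module_scheme"
  assumes "etale F A" "e \<in> primitive_idempotents A"
  obtains L :: "('f, 'a) module" and h
  where "finite_separable_extension F L" "h \<in> alg_iso F (component A e) L"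
proof -
  have "algebra F A" using assms(1) by (simp add: etale_def)
  interpret A: algebra F A by fact
  have e': "e \<in> idempotents A" using assms(2) by (simp add: primitive_idempotents_def)
  then have e: "e \<in> carrier A" "e \<otimes>\<^bsub>A\<^esub> e = e" "e \<noteq> \<zero>\<^bsub>A\<^esub>"
    by (auto simp: idempotents_def)
  note mem = component_carrier_iff[OF A.M_cring e']
  obtain n and L :: "nat \<Rightarrow> ('f, 'a) module" and f where L: "\<And>i. i < n \<Longrightarrow> finite_separable_extension F (L i)"
    and f: "f \<in> alg_iso F A (prod_algebra {..<n} L)"
    using assms(1) by (auto simp: etale_def)
  let ?P = "prod_algebra {..<n} L"
  have fhom: "f \<in> alg_hom F A ?P" and finj: "inj_on f (carrier A)"
    and fsurj: "f ` carrier A = (\<Pi>\<^sub>E i\<in>{..<n}. carrier (L i))"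
    using f by (auto simp: alg_iso_def bij_betw_def prod_algebra_def)
  have fP: "f x \<in> (\<Pi>\<^sub>E i\<in>{..<n}. carrier (L i))" if "x \<in> carrier A" for x
    using alg_homD(2)[OF fhom that] by (simp add: prod_algebra_def)
  have field: "field (L i)" if "i < n" for i
    using L[OF that] by (simp add: finite_separable_extension_def)
  have proj: "(\<lambda>x. f x i) \<in> alg_hom F A (L i)" if "i < n" for i
    using alg_homD[OF fhom] that fP
    by (intro alg_homI) (auto simp: prod_algebra_def PiE_iff)
  have proj0: "f \<zero>\<^bsub>A\<^esub> i = \<zero>\<^bsub>L i\<^esub>" if "i < n" for i
    using ring_hom_zero[OF alg_homD(1)[OF proj[OF that]] A.ring_axioms] field[OF that]
    by (simp add: field_def domain_def cring_def)
  have eqI: "x = y" if "x \<in> carrier A" "y \<in> carrier A" "\<And>i. i < n \<Longrightarrow> f x i = f y i" for x y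
  proof -
    have "f x = f y"
      using fP[OF that(1)] fP[OF that(2)] that(3) by (intro PiE_ext[of _ "{..<n}"]) auto
    then show ?thesis using finj that by (auto dest: inj_onD)
  qed
  have e01: "f e i = \<zero>\<^bsub>L i\<^esub> \<or> f e i = \<one>\<^bsub>L i\<^esub>" if i: "i < n" for i
  proof -
    interpret Li: field "L i" using field[OF i] .
    have c: "f e i \<in> carrier (L i)" "f e i \<otimes>\<^bsub>L i\<^esub> f e i = f e i"
      using alg_homD(2,3)[OF proj[OF i]] e by metis+
    then have "f e i \<otimes>\<^bsub>L i\<^esub> (f e i \<ominus>\<^bsub>L i\<^esub> \<one>\<^bsub>L i\<^esub>) = \<zero>\<^bsub>L i\<^esub>"
      by (simp add: Li.minus_eq Li.r_distr Li.r_minus Li.r_neg)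
    then show ?thesis
      using c Li.integral[of "f e i" "f e i \<ominus>\<^bsub>L i\<^esub> \<one>\<^bsub>L i\<^esub>"] by auto
  qed
  have "\<exists>i<n. f e i \<noteq> f \<zero>\<^bsub>A\<^esub> i"
    using eqI[of e "\<zero>\<^bsub>A\<^esub>"] e by auto
  then obtain i where i: "i < n" "f e i = \<one>\<^bsub>L i\<^esub>"
    using e01 proj0 by metis
  interpret Li: field "L i" using field[OF i(1)] .
  have cring: "cring (L j)" if "j < n" for j
    using field[OF that] by (simp add: field_def domain_def)
  have unit_vec: "(\<lambda>j\<in>{..<n}. if j = i then y else \<zero>\<^bsub>L j\<^esub>) \<in> f ` carrier A"
    if "y \<in> carrier (L i)" for y
    unfolding fsurj using that cring.cring_simprules(2)[OF cring] by auto
  \<comment> \<open>Coordinate \<open>i\<close> is one where \<open>f e\<close> is 1, and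
    \<open>w\<close> is the preimage of the unit vector there. It is a nonzero idempotent with
    \<open>e \<otimes> w = w\<close>, so primitivity forces \<open>w = e\<close>.\<close>
  obtain w where w: "w \<in> carrier A" "f w = (\<lambda>j\<in>{..<n}. if j = i then \<one>\<^bsub>L i\<^esub> else \<zero>\<^bsub>L j\<^esub>)"
    using unit_vec[OF Li.one_closed] by (metis (no_types, lifting) imageE)
  have w_mult: "f (x \<otimes>\<^bsub>A\<^esub> w) j = (if j = i then f x i else \<zero>\<^bsub>L j\<^esub>)"
    if "x \<in> carrier A" "j < n" for x j
  proof -
    interpret Lj: cring "L j" using cring[OF that(2)] .
    have "f (x \<otimes>\<^bsub>A\<^esub> w) j = f x j \<otimes>\<^bsub>L j\<^esub> f w j" "f x j \<in> carrier (L j)"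
      using alg_homD(2,3)[OF proj[OF that(2)]] that w by auto
    then show ?thesis using that w(2) by auto
  qed
  have "w \<otimes>\<^bsub>A\<^esub> w = w"
    using w(1) i w_mult[OF w(1)] w(2) by - (rule eqI, auto)
  moreover have "e \<otimes>\<^bsub>A\<^esub> w = w"
    using w(1) e(1) i w_mult[OF e(1)] w(2) by - (rule eqI, auto)
  moreover have "w \<noteq> \<zero>\<^bsub>A\<^esub>"
    using w(2) proj0[OF i(1)] i(1) Li.one_not_zero by force
  ultimately have "w = e"
    using primitive_idempotent_mult[OF A.M_cring assms(2) w(1)] by auto
  then have e_mult: "f (e \<otimes>\<^bsub>A\<^esub> x) j = (if j = i then f x i else \<zero>\<^bsub>L j\<^esub>)"
    if "x \<in> carrier A" "j < n" for x j
    using w_mult[OF that] e that by (simp add: A.m_comm)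
  have "(\<lambda>x. f x i) \<in> alg_hom F (component A e) (L i)"
    using alg_homD[OF proj[OF i(1)]] i by (intro alg_homI) (auto simp: mem)
  moreover have "inj_on (\<lambda>x. f x i) (carrier (component A e))"
  proof (rule inj_onI)
    fix x y assume xy: "x \<in> carrier (component A e)" "y \<in> carrier (component A e)" "f x i = f y i"
    show "x = y"
    proof (rule eqI)
      fix j assume j: "j < n"
      show "f x j = f y j"
        using e_mult[of x j] e_mult[of y j] xy j unfolding mem by (metis (full_types))
    qed (use xy in \<open>auto simp: mem\<close>)
  qed
  moreover have "(\<lambda>x. f x i) ` carrier (component A e) = carrier (L i)"
  proof (intro equalityI subsetI)
    fix y assume y: "y \<in> carrier (L i)"
    then obtain a where a: "a \<in> carrier A" "f a = (\<lambda>j\<in>{..<n}. if j = i then y else \<zero>\<^bsub>L j\<^esub>)"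
      using unit_vec[OF y] by (metis (no_types, lifting) imageE)
    then have "f (e \<otimes>\<^bsub>A\<^esub> a) i = y"
      using e_mult[of a i] i by simp
    moreover have "e \<otimes>\<^bsub>A\<^esub> a \<in> carrier (component A e)"
      using a by (auto simp: component_def)
    ultimately show "y \<in> (\<lambda>x. f x i) ` carrier (component A e)" by auto
  qed (use alg_homD(2)[OF proj[OF i(1)]] in \<open>auto simp: mem\<close>)
  ultimately have "(\<lambda>x. f x i) \<in> alg_iso F (component A e) (L i)"
    by (simp add: alg_iso_def bij_betw_def)
  with L[OF i(1)] show ?thesis by (rule that)
qed

lemma primitive_component_field:
  assumes "etale F A" "e \<in> primitive_idempotents A"
  shows "field (component A e)"
proof -
  have "algebra F (component A e)"
    using assms by (intro component_algebra) (auto simp: etale_def primitive_idempotents_def)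
  then show ?thesis
    using primitive_component_alg_iso[OF assms] field_alg_iso algebra.M_cring
    by (metis finite_separable_extension_def)
qed

text \<open>The component is presented as a product with one factor. That factor is the
  \<open>L\<close> supplied by the etaleness of \<open>A\<close>, so its separability is already
  known and no minimal polynomial of \<open>eA\<close> has to be examined.\<close>

lemma primitive_component_etale:
  fixes A :: "('f, 'a, 'm) module_scheme"
  assumes "etale F A" "e \<in> primitive_idempotents A"
  shows "etale F (component A e)"
proof -
  obtain L :: "('f, 'a) module" and h
    where L: "finite_separable_extension F L" and h: "h \<in> alg_iso F (component A e) L"
    using primitive_component_alg_iso[OF assms] .
  have alg: "algebra F (component A e)"
    using assms by (intro component_algebra) (auto simp: etale_def primitive_idempotents_def)
  let ?P = "prod_algebra {..<1::nat} (\<lambda>_. L)"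
  define k where "k x = (\<lambda>i\<in>{..<1::nat}. h x)" for x
  have h': "h \<in> alg_hom F (component A e) L" "bij_betw h (carrier (component A e)) (carrier L)"
    using h by (auto simp: alg_iso_def)
  have "k \<in> alg_hom F (component A e) ?P"
    using alg_homD[OF h'(1)] by (intro alg_homI) (auto simp: prod_algebra_def k_def)
  moreover have "bij_betw k (carrier (component A e)) (carrier ?P)"
  proof -
    have "bij_betw (\<lambda>y. \<lambda>i\<in>{..<1::nat}. y) (carrier L) (carrier ?P)"
    proof (rule bij_betw_byWitness[where f' = "\<lambda>y. y 0"])
      show "\<forall>y\<in>carrier ?P. (\<lambda>i\<in>{..<1::nat}. y 0) = y"
        by (auto simp: prod_algebra_def PiE_iff extensional_def fun_eq_iff)
    qed (auto simp: prod_algebra_def split: if_splits)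
    from bij_betw_trans[OF h'(2) this] show ?thesis
      by (simp add: k_def[abs_def] comp_def)
  qed
  ultimately have "k \<in> alg_iso F (component A e) ?P"
    by (simp add: alg_iso_def)
  with alg L show ?thesis
    unfolding etale_def by (intro conjI exI[of _ "1::nat"] exI[of _ "\<lambda>_. L"]) auto
qed

section \<open>The orbit of a primitive idempotent\<close>

sublocale galois_algebra \<subseteq> algebra_action
  using action_hom by unfold_locales

locale galois_algebra_idempotent = galois_algebra G F A \<phi>
  for G :: "('g, 'p) monoid_scheme" (structure)
    and F :: "('f, 'k) ring_scheme"
    and A :: "('f, 'a, 'm) module_scheme"
    and \<phi> :: "'g \<Rightarrow> 'a \<Rightarrow> 'a" +
  fixes e :: 'a
  assumes primitive: "e \<in> primitive_idempotents A"
begin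

abbreviation "H \<equiv> stabilizer G \<phi> e"
abbreviation "G\<^sub>e \<equiv> G\<lparr>carrier := H\<rparr>"
abbreviation "E \<equiv> component A e"
abbreviation "\<psi> \<equiv> component_action A \<phi> e"
abbreviation "orb \<equiv> orbit G \<phi> e"

lemma idempotent: "e \<in> idempotents A"
  using primitive by (simp add: primitive_idempotents_def)

lemma e: "e \<in> carrier A" "e \<otimes>\<^bsub>A\<^esub> e = e" "e \<noteq> \<zero>\<^bsub>A\<^esub>"
  using idempotent by (auto simp: idempotents_def)

lemma one_not_zero: "\<one>\<^bsub>A\<^esub> \<noteq> \<zero>\<^bsub>A\<^esub>"
  using e A.r_one[of e] A.r_null[of e] by metis

lemma mem_E: "x \<in> carrier E \<longleftrightarrow> x \<in> carrier A \<and> e \<otimes>\<^bsub>A\<^esub> x = x"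
  using component_carrier_iff[OF A.M_cring idempotent] .

lemma H_iff: "h \<in> H \<longleftrightarrow> h \<in> carrier G \<and> \<phi> h e = e"
  by (simp add: stabilizer_def)

lemma H_subgroup: "subgroup H G"
  using group_action.stabilizer_subgroup[OF is_group_action e(1)] .

lemma orb_closed: "u \<in> orb \<Longrightarrow> u \<in> carrier A"
  using e by (auto simp: orbit_def)

lemma orb_act: "\<lbrakk>g \<in> carrier G; u \<in> orb\<rbrakk> \<Longrightarrow> \<phi> g u \<in> orb"
  using e by (auto simp: orbit_def act_act)

lemma e_in_orb: "e \<in> orb"
  using e act_one_group[of e] by (auto simp: orbit_def intro!: exI[of _ \<one>])

lemma orb_image: "g \<in> carrier G \<Longrightarrow> \<phi> g ` orb = orb"
proof (intro equalityI subsetI)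
  fix u assume g: "g \<in> carrier G" and u: "u \<in> orb"
  then have "u = \<phi> g (\<phi> (inv g) u)" "\<phi> (inv g) u \<in> orb"
    using orb_closed orb_act by auto
  then show "u \<in> \<phi> g ` orb" by blast
qed (auto intro: orb_act)

lemma finite_orb: "finite orb"
proof -
  have "orb = (\<lambda>g. \<phi> g e) ` carrier G" by (auto simp: orbit_def)
  then show ?thesis using finite_group by simp
qed

lemma orb_idempotent: "u \<in> orb \<Longrightarrow> u \<otimes>\<^bsub>A\<^esub> u = u"
  using e by (auto simp: orbit_def act_mult[symmetric])

text \<open>By translation one of the two elements is \<open>e\<close>; let the other be
  \<open>w = \<phi> g e\<close>. Primitivity is known for \<open>e\<close> only, so it is applied to
  \<open>e\<close> twice. If \<open>e \<otimes> w\<close> is nonzero, it equals \<open>e\<close>.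
  Translating back by \<open>g\<close>, the product of \<open>e\<close> with
  \<open>\<phi> (inv g) e\<close> is nonzero too and equals \<open>e\<close>. Comparing the two
  gives \<open>\<phi> g e = e\<close>.\<close>

lemma orb_orthogonal:
  assumes "u \<in> orb" "v \<in> orb" "u \<noteq> v"
  shows "u \<otimes>\<^bsub>A\<^esub> v = \<zero>\<^bsub>A\<^esub>"
proof -
  have e_orth: "e \<otimes>\<^bsub>A\<^esub> w = \<zero>\<^bsub>A\<^esub>" if w: "w \<in> orb" "w \<noteq> e" for w
  proof (rule ccontr)
    assume ne: "e \<otimes>\<^bsub>A\<^esub> w \<noteq> \<zero>\<^bsub>A\<^esub>"
    obtain g where g: "g \<in> carrier G" "w = \<phi> g e"
      using w by (auto simp: orbit_def)
    have wc: "w \<in> carrier A" using w orb_closed by auto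
    define v where "v = \<phi> (inv g) e"
    have v: "v \<in> orb" "v \<in> carrier A" "\<phi> g v = e"
      using g e e_in_orb orb_act by (auto simp: v_def)
    have ew: "e \<otimes>\<^bsub>A\<^esub> w = e"
      using primitive_idempotent_mult[OF A.M_cring primitive wc] ne orb_idempotent w by auto
    have ge: "\<phi> g (e \<otimes>\<^bsub>A\<^esub> v) = e \<otimes>\<^bsub>A\<^esub> w"
      using g e v wc by (simp add: act_mult A.m_comm)
    then have "e \<otimes>\<^bsub>A\<^esub> v \<noteq> \<zero>\<^bsub>A\<^esub>"
      using ne g by auto
    then have "e \<otimes>\<^bsub>A\<^esub> v = e"
      using primitive_idempotent_mult[OF A.M_cring primitive v(2)] orb_idempotent v by auto
    then show False using ge ew g w by simp
  qed
  obtain g where g: "g \<in> carrier G" "u = \<phi> g e"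
    using assms by (auto simp: orbit_def)
  define w where "w = \<phi> (inv g) v"
  have w: "w \<in> orb" "w \<in> carrier A" "v = \<phi> g w"
    using g assms(2) orb_closed orb_act by (auto simp: w_def)
  then have "u \<otimes>\<^bsub>A\<^esub> v = \<phi> g (e \<otimes>\<^bsub>A\<^esub> w)"
    using g e by (simp add: act_mult)
  also have "\<dots> = \<zero>\<^bsub>A\<^esub>"
  proof -
    have "w \<noteq> e" using w g assms(3) by metis
    then show ?thesis using e_orth w g by simp
  qed
  finally show ?thesis .
qed

text \<open>Multiplication by \<open>v\<close> projects to the summand of \<open>v\<close>. Every
  gluing along the orbit relies on this: an element assembled from pieces \<open>f u\<close> has
  exactly these pieces as its components.\<close>

lemma orb_mult_finsum:
  assumes "v \<in> orb" "\<And>u. u \<in> orb \<Longrightarrow> f u \<in> carrier A \<and> u \<otimes>\<^bsub>A\<^esub> f u = f u"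
  shows "v \<otimes>\<^bsub>A\<^esub> (\<Oplus>\<^bsub>A\<^esub>u\<in>orb. f u) = f v"
proof -
  have "v \<otimes>\<^bsub>A\<^esub> (\<Oplus>\<^bsub>A\<^esub>u\<in>orb. f u) = (\<Oplus>\<^bsub>A\<^esub>u\<in>orb. v \<otimes>\<^bsub>A\<^esub> f u)"
    using assms finite_orb orb_closed by (intro A.finsum_rdistr) auto
  also have "\<dots> = (\<Oplus>\<^bsub>A\<^esub>u\<in>orb. if v = u then f u else \<zero>\<^bsub>A\<^esub>)"
  proof (rule A.finsum_cong')
    fix u assume u: "u \<in> orb"
    have "v \<otimes>\<^bsub>A\<^esub> f u = v \<otimes>\<^bsub>A\<^esub> u \<otimes>\<^bsub>A\<^esub> f u"
      using assms u orb_closed by (simp add: A.m_assoc)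
    then show "v \<otimes>\<^bsub>A\<^esub> f u = (if v = u then f u else \<zero>\<^bsub>A\<^esub>)"
      using assms u orb_orthogonal[of v u] by auto
  qed (use assms in auto)
  also have "\<dots> = f v"
    using assms finite_orb by (intro A.add.finprod_singleton) auto
  finally show ?thesis .
qed

lemma orb_sum: "(\<Oplus>\<^bsub>A\<^esub>u\<in>orb. u) = \<one>\<^bsub>A\<^esub>"
proof -
  define s where "s = (\<Oplus>\<^bsub>A\<^esub>u\<in>orb. u)"
  have s: "s \<in> carrier A"
    unfolding s_def using orb_closed by (intro A.finsum_closed) auto
  have "\<phi> g s = s" if g: "g \<in> carrier G" for g
  proof -
    have "\<phi> g s = (\<Oplus>\<^bsub>A\<^esub>u\<in>orb. \<phi> g u)"
      unfolding s_def using g orb_closed by (intro act_finsum) auto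
    also have "\<dots> = (\<Oplus>\<^bsub>A\<^esub>u\<in>\<phi> g ` orb. u)"
      using g orb_closed by (intro A.finsum_reindex[symmetric] inj_on_subset[OF act_inj]) auto
    finally show ?thesis using orb_image[OF g] by (simp add: s_def)
  qed
  then have "s \<in> scalars F A" using invariants s by auto
  then obtain k where k: "k \<in> carrier F" "s = k \<odot>\<^bsub>A\<^esub> \<one>\<^bsub>A\<^esub>"
    by (auto simp: scalars_def)
  have es: "e \<otimes>\<^bsub>A\<^esub> s = e"
    unfolding s_def using e_in_orb orb_closed orb_idempotent by (intro orb_mult_finsum) auto
  \<comment> \<open>Multiplying the scalar by \<open>e\<close> tests its value. If \<open>k\<close>
    were not 1, then \<open>k - 1\<close> would be an invertible scalar that kills \<open>e\<close>,
    and \<open>e\<close> would be zero.\<close>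
  have "k \<odot>\<^bsub>A\<^esub> e = e"
    using es k e A.smult_assoc2[of k "\<one>\<^bsub>A\<^esub>" e] A.m_comm[of e s] s by simp
  have "k = \<one>\<^bsub>F\<^esub>"
  proof (rule ccontr)
    assume "k \<noteq> \<one>\<^bsub>F\<^esub>"
    define c where "c = k \<ominus>\<^bsub>F\<^esub> \<one>\<^bsub>F\<^esub>"
    have c: "c \<in> carrier F" "c \<noteq> \<zero>\<^bsub>F\<^esub>"
      using k \<open>k \<noteq> \<one>\<^bsub>F\<^esub>\<close> by (auto simp: c_def)
    then have "c \<in> Units F"
      using F.field_Units by auto
    then have ic: "inv\<^bsub>F\<^esub> c \<in> carrier F" "inv\<^bsub>F\<^esub> c \<otimes>\<^bsub>F\<^esub> c = \<one>\<^bsub>F\<^esub>"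
      by (auto intro: F.Units_l_inv)
    have "c \<odot>\<^bsub>A\<^esub> e = \<zero>\<^bsub>A\<^esub>"
      using k e \<open>k \<odot>\<^bsub>A\<^esub> e = e\<close>
      by (simp add: c_def a_minus_def A.smult_l_distr A.smult_l_minus A.r_neg)
    then have "\<one>\<^bsub>F\<^esub> \<odot>\<^bsub>A\<^esub> e = \<zero>\<^bsub>A\<^esub>"
      using ic c e A.smult_assoc1[of "inv\<^bsub>F\<^esub> c" c e] by simp
    then show False using e by simp
  qed
  then show ?thesis using k s_def by simp
qed

text \<open>Since the orbit sums to 1, every element is the sum of its products with the
  orbit.\<close>

lemma eq_via_orb:
  assumes "x \<in> carrier A" "y \<in> carrier A" "\<And>u. u \<in> orb \<Longrightarrow> u \<otimes>\<^bsub>A\<^esub> x = u \<otimes>\<^bsub>A\<^esub> y"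
  shows "x = y"
proof -
  have sum: "z = (\<Oplus>\<^bsub>A\<^esub>u\<in>orb. u \<otimes>\<^bsub>A\<^esub> z)" if "z \<in> carrier A" for z
    using A.finsum_ldistr[OF finite_orb that, of "\<lambda>u. u"] orb_sum orb_closed that by auto
  have "(\<Oplus>\<^bsub>A\<^esub>u\<in>orb. u \<otimes>\<^bsub>A\<^esub> x) = (\<Oplus>\<^bsub>A\<^esub>u\<in>orb. u \<otimes>\<^bsub>A\<^esub> y)"
    using assms orb_closed by (intro A.finsum_cong') auto
  then show ?thesis using sum assms by metis
qed

text \<open>A choice of coset representatives of the stabilizer. Two candidates for
  \<open>rep u\<close> differ by an element of \<open>H\<close> on the right, so pieces built from
  data compatible with \<open>H\<close> do not depend on the choice.\<close>

definition rep :: "'a \<Rightarrow> 'g" where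
  "rep u = (SOME g. g \<in> carrier G \<and> \<phi> g e = u)"

lemma rep: "u \<in> orb \<Longrightarrow> rep u \<in> carrier G" "u \<in> orb \<Longrightarrow> \<phi> (rep u) e = u"
  unfolding rep_def by (rule someI2_ex; auto simp: orbit_def)+

lemma H_intro: "\<lbrakk>g \<in> carrier G; k \<in> carrier G; \<phi> g e = \<phi> k e\<rbrakk> \<Longrightarrow> inv k \<otimes> g \<in> H"
  using e by (simp add: H_iff act_act[symmetric])

section \<open>The component as a Galois extension\<close>

lemma E_algebra: "algebra F E"
  using component_algebra[OF A.algebra_axioms idempotent] .

lemma E_field: "field E"
  using primitive_component_field[OF etale primitive] .

lemma act_E: "\<lbrakk>h \<in> H; x \<in> carrier E\<rbrakk> \<Longrightarrow> \<phi> h x \<in> carrier E"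
  using e act_mult[of h e x] by (auto simp: mem_E H_iff)

lemma component_act [simp]: "x \<in> carrier E \<Longrightarrow> \<psi> h x = \<phi> h x"
  by (simp add: component_action_def)

lemma E_action: "algebra_action G\<^sub>e F E \<psi>"
proof -
  interpret H: group G\<^sub>e
    using subgroup_imp_group[OF H_subgroup] .
  interpret E: algebra F E by (rule E_algebra)
  have sub: "x \<in> carrier A" if "x \<in> carrier E" for x
    using that by (simp add: mem_E)
  have HG: "h \<in> carrier G" if "h \<in> H" for h
    using that by (simp add: H_iff)
  have Hinv: "inv h \<in> H" if "h \<in> H" for h
    using subgroup.m_inv_closed[OF H_subgroup that] .
  have Aut: "\<psi> h \<in> carrier (Aut_alg F E)" if h: "h \<in> H" for h
  proof -
    have "\<psi> h \<in> alg_hom F E E"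
      using h HG[OF h] sub act_E E.add.m_closed E.m_closed E.smult_closed E.one_closed
      by (intro alg_homI) (auto simp: act_mult act_add act_smult H_iff)
    moreover have "bij_betw (\<psi> h) (carrier E) (carrier E)"
      using h HG[OF h] Hinv[OF h] sub act_E
      by (intro bij_betw_byWitness[where f' = "\<psi> (inv h)"]) auto
    ultimately show ?thesis
      by (simp add: Aut_alg_carrier Bij_def component_action_def)
  qed
  have "\<psi> \<in> hom G\<^sub>e (Aut_alg F E)"
  proof (rule homI)
    fix g h assume gh: "g \<in> carrier G\<^sub>e" "h \<in> carrier G\<^sub>e"
    then have "\<psi> (g \<otimes> h) x = compose (carrier E) (\<psi> g) (\<psi> h) x" for x
      using act_E[of h x] HG sub
      by (cases "x \<in> carrier E") (auto simp: compose_def act_act component_action_def)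
    then show "\<psi> (g \<otimes>\<^bsub>G\<^sub>e\<^esub> h) = \<psi> g \<otimes>\<^bsub>Aut_alg F E\<^esub> \<psi> h"
      using gh Aut by (auto simp: Aut_alg_mult)
  qed (use Aut in simp)
  then show ?thesis
    by (intro algebra_action.intro H.is_group E_algebra algebra_action_axioms.intro)
qed

lemma E_invariants: "{x \<in> carrier E. \<forall>h\<in>carrier G\<^sub>e. \<psi> h x = x} = scalars F E"
proof (intro equalityI subsetI)
  fix x assume x: "x \<in> {x \<in> carrier E. \<forall>h\<in>carrier G\<^sub>e. \<psi> h x = x}"
  then have xE: "x \<in> carrier E" "x \<in> carrier A" "e \<otimes>\<^bsub>A\<^esub> x = x"
    and fixed: "\<And>h. h \<in> H \<Longrightarrow> \<phi> h x = x"
    by (auto simp: mem_E)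
  define f where "f u = \<phi> (rep u) x" for u
  have f: "f u \<in> carrier A" "u \<otimes>\<^bsub>A\<^esub> f u = f u" if "u \<in> orb" for u
    using rep[OF that] xE e act_mult[of "rep u" e x] by (auto simp: f_def)
  \<comment> \<open>Both \<open>rep (\<phi> g u)\<close> and \<open>g \<otimes> rep u\<close> send
    \<open>e\<close> to \<open>\<phi> g u\<close>. They differ by an element of \<open>H\<close>,
    and this fixes \<open>x\<close>.\<close>
  have f_act: "f (\<phi> g u) = \<phi> g (f u)" if "g \<in> carrier G" "u \<in> orb" for g u
  proof -
    note r = rep[OF that(2)] and r' = rep[OF orb_act[OF that]]
    have "inv (rep (\<phi> g u)) \<otimes> (g \<otimes> rep u) \<in> H"
      using r r' that e by (intro H_intro) (auto simp: act_act[symmetric])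
    then have "\<phi> (inv (rep (\<phi> g u)) \<otimes> (g \<otimes> rep u)) x = x" by (rule fixed)
    then have "\<phi> (rep (\<phi> g u)) (\<phi> (inv (rep (\<phi> g u))) (\<phi> (g \<otimes> rep u) x)) = \<phi> (rep (\<phi> g u)) x"
      using r r' that xE by (simp add: act_act)
    then show ?thesis
      unfolding f_def using r r' that xE by (simp add: act_act[of g "rep u"])
  qed
  define y where "y = (\<Oplus>\<^bsub>A\<^esub>u\<in>orb. f u)"
  have y: "y \<in> carrier A"
    unfolding y_def using f by (intro A.finsum_closed) auto
  have "\<phi> g y = y" if g: "g \<in> carrier G" for g
  proof -
    have "\<phi> g y = (\<Oplus>\<^bsub>A\<^esub>u\<in>orb. \<phi> g (f u))"
      unfolding y_def using g f by (intro act_finsum) auto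
    also have "\<dots> = (\<Oplus>\<^bsub>A\<^esub>u\<in>orb. f (\<phi> g u))"
      using g f orb_act by (intro A.finsum_cong') (auto simp: f_act)
    also have "\<dots> = (\<Oplus>\<^bsub>A\<^esub>u\<in>\<phi> g ` orb. f u)"
      using g f orb_act orb_closed
      by (intro A.finsum_reindex[symmetric] inj_on_subset[OF act_inj]) auto
    finally show ?thesis using orb_image[OF g] by (simp add: y_def)
  qed
  then have "y \<in> scalars F A" using invariants y by auto
  then obtain k where k: "k \<in> carrier F" "y = k \<odot>\<^bsub>A\<^esub> \<one>\<^bsub>A\<^esub>"
    by (auto simp: scalars_def)
  have "f e = e \<otimes>\<^bsub>A\<^esub> y"
    unfolding y_def using f e_in_orb by (intro orb_mult_finsum[symmetric]) auto
  also have "\<dots> = k \<odot>\<^bsub>A\<^esub> e"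
    using k e y A.smult_assoc2[of k "\<one>\<^bsub>A\<^esub>" e] A.m_comm[of e y] by simp
  \<comment> \<open>\<open>rep e\<close> need not be the identity, but it lies in \<open>H\<close>
    and therefore fixes \<open>x\<close>.\<close>
  also have "f e = x"
    using rep[OF e_in_orb] fixed by (simp add: f_def H_iff)
  finally show "x \<in> scalars F E"
    using k by (auto simp: scalars_def)
next
  interpret E: algebra F E by (rule E_algebra)
  fix x assume "x \<in> scalars F E"
  then obtain k where k: "k \<in> carrier F" "x = k \<odot>\<^bsub>A\<^esub> e"
    by (auto simp: scalars_def)
  then have "x \<in> carrier E"
    using E.smult_closed[OF k(1) E.one_closed] by simp
  then show "x \<in> {x \<in> carrier E. \<forall>h\<in>carrier G\<^sub>e. \<psi> h x = x}"
    using k e by (auto simp: act_smult H_iff)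
qed

section \<open>The dimension of the component, counted along the orbit\<close>

lemma orb_mult_sum:
  assumes "v \<in> orb" "U \<subseteq> orb"
  shows "v \<otimes>\<^bsub>A\<^esub> (\<Oplus>\<^bsub>A\<^esub>u\<in>U. u) = (if v \<in> U then v else \<zero>\<^bsub>A\<^esub>)"
  using finite_subset[OF assms(2) finite_orb] assms(2)
proof (induction U rule: finite_induct)
  case empty
  then show ?case using assms(1) orb_closed by simp
next
  case (insert u U)
  have cl: "v \<in> carrier A" "u \<in> carrier A" "U \<subseteq> carrier A" "u \<in> orb"
    using insert.prems assms(1) orb_closed by auto
  then have "v \<otimes>\<^bsub>A\<^esub> (\<Oplus>\<^bsub>A\<^esub>u\<in>insert u U. u) = v \<otimes>\<^bsub>A\<^esub> u \<oplus>\<^bsub>A\<^esub> (if v \<in> U then v else \<zero>\<^bsub>A\<^esub>)"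
    using insert by (simp add: A.finsum_insert A.finsum_closed A.r_distr subset_eq Pi_def)
  then show ?case
    using cl insert.hyps orb_idempotent[OF assms(1)] orb_orthogonal[OF assms(1) cl(4)] by auto
qed

text \<open>The action carries \<open>eA\<close> onto the component of any other orbit element, so
  all these components have the same dimension.\<close>

lemma act_component_carrier:
  assumes "g \<in> carrier G"
  shows "\<phi> g ` carrier E = (\<otimes>\<^bsub>A\<^esub>) (\<phi> g e) ` carrier A"
proof (intro equalityI subsetI)
  fix x assume "x \<in> \<phi> g ` carrier E"
  then show "x \<in> (\<otimes>\<^bsub>A\<^esub>) (\<phi> g e) ` carrier A"
    using assms e by (auto simp: component_def act_mult)
next
  fix x assume "x \<in> (\<otimes>\<^bsub>A\<^esub>) (\<phi> g e) ` carrier A"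
  then obtain a where a: "a \<in> carrier A" "x = \<phi> g e \<otimes>\<^bsub>A\<^esub> a" by auto
  then have "x = \<phi> g (e \<otimes>\<^bsub>A\<^esub> \<phi> (inv g) a)"
    using assms e by (simp add: act_mult)
  then show "x \<in> \<phi> g ` carrier E"
    using a assms by (auto simp: component_def)
qed

lemma card_H_dvd: "card H dvd order G"
  using group_action.orbit_stabilizer_theorem[OF is_group_action e(1)] by (metis dvd_triv_right)

text \<open>Partial sums of the orbit make an induction possible: for orthogonal idempotents
  \<open>u\<close> and \<open>s\<close>, the space (u + s)A is the direct sum of uA and sA. Each new
  summand contributes \<open>m\<close>, being the image of \<open>eA\<close> under an injective
  linear map.\<close>

lemma orb_component_dimension:
  assumes "A.dimension m (scalars F A) (carrier E)" "finite U" "U \<subseteq> orb"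
  shows "A.dimension (card U * m) (scalars F A) ((\<otimes>\<^bsub>A\<^esub>) (\<Oplus>\<^bsub>A\<^esub>u\<in>U. u) ` carrier A)"
  using assms(2,3)
proof (induction U rule: finite_induct)
  case empty
  have "(\<otimes>\<^bsub>A\<^esub>) \<zero>\<^bsub>A\<^esub> ` carrier A = {\<zero>\<^bsub>A\<^esub>}"
    using A.zero_closed A.l_null by (auto simp: image_iff)
  then show ?case by simp
next
  case (insert u U)
  note K = scalars_subfield(2)[OF F.field_axioms A.algebra_axioms one_not_zero]
  have U: "U \<subseteq> carrier A" "u \<in> carrier A" "u \<in> orb"
    using insert orb_closed by auto
  define s where "s = (\<Oplus>\<^bsub>A\<^esub>u\<in>U. u)"
  have s: "s \<in> carrier A"
    unfolding s_def using U by (intro A.finsum_closed) auto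
  have uu: "u \<otimes>\<^bsub>A\<^esub> u = u" using orb_idempotent U by auto
  have us: "u \<otimes>\<^bsub>A\<^esub> s = \<zero>\<^bsub>A\<^esub>"
    using orb_mult_sum[of u U] insert by (simp add: s_def)
  have "s \<otimes>\<^bsub>A\<^esub> s = (\<Oplus>\<^bsub>A\<^esub>v\<in>U. v \<otimes>\<^bsub>A\<^esub> s)"
    unfolding s_def using U insert s by (intro A.finsum_ldistr) (auto simp: s_def)
  also have "\<dots> = s"
    using orb_mult_sum[of _ U] insert U by (subst (2) s_def, intro A.finsum_cong') (auto simp: s_def)
  finally have ss: "s \<otimes>\<^bsub>A\<^esub> s = s" .
  obtain g where g: "g \<in> carrier G" "u = \<phi> g e"
    using U by (auto simp: orbit_def)
  have "A.dimension m (scalars F A) (\<phi> g ` carrier E)"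
    using g inj_on_subset[OF act_inj[OF g(1)], of "carrier E"]
    by (intro dimension_linear_image[OF F.field_axioms A.algebra_axioms one_not_zero A.algebra_axioms assms(1)])
       (auto simp: mem_E act_add act_smult subset_eq)
  then have dim_u: "A.dimension m (scalars F A) ((\<otimes>\<^bsub>A\<^esub>) u ` carrier A)"
    using act_component_carrier g by simp
  have dim_s: "A.dimension (card U * m) (scalars F A) ((\<otimes>\<^bsub>A\<^esub>) s ` carrier A)"
    unfolding s_def using insert by auto
  have "(\<otimes>\<^bsub>A\<^esub>) u ` carrier A \<inter> (\<otimes>\<^bsub>A\<^esub>) s ` carrier A = {\<zero>\<^bsub>A\<^esub>}"
  proof (intro equalityI subsetI)
    fix x assume "x \<in> (\<otimes>\<^bsub>A\<^esub>) u ` carrier A \<inter> (\<otimes>\<^bsub>A\<^esub>) s ` carrier A"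
    then obtain a b where ab: "a \<in> carrier A" "b \<in> carrier A" "x = u \<otimes>\<^bsub>A\<^esub> a" "x = s \<otimes>\<^bsub>A\<^esub> b"
      by auto
    have "u \<otimes>\<^bsub>A\<^esub> x = (u \<otimes>\<^bsub>A\<^esub> u) \<otimes>\<^bsub>A\<^esub> a" "u \<otimes>\<^bsub>A\<^esub> x = (u \<otimes>\<^bsub>A\<^esub> s) \<otimes>\<^bsub>A\<^esub> b"
      using A.m_assoc[of u u a] A.m_assoc[of u s b] ab U s by simp_all
    then show "x \<in> {\<zero>\<^bsub>A\<^esub>}"
      using uu us ab by simp
  qed (use U s A.r_null in \<open>auto simp: image_iff intro!: bexI[of _ "\<zero>\<^bsub>A\<^esub>"]\<close>)
  then have "A.dimension (m + card U * m) (scalars F A)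
      ((\<otimes>\<^bsub>A\<^esub>) u ` carrier A <+>\<^bsub>A\<^esub> (\<otimes>\<^bsub>A\<^esub>) s ` carrier A)"
    by (rule A.dimension_direct_sum_space[OF K dim_u dim_s])
  moreover have "(\<otimes>\<^bsub>A\<^esub>) u ` carrier A <+>\<^bsub>A\<^esub> (\<otimes>\<^bsub>A\<^esub>) s ` carrier A = (\<otimes>\<^bsub>A\<^esub>) (u \<oplus>\<^bsub>A\<^esub> s) ` carrier A"
  proof (intro equalityI subsetI)
    fix x assume "x \<in> (\<otimes>\<^bsub>A\<^esub>) u ` carrier A <+>\<^bsub>A\<^esub> (\<otimes>\<^bsub>A\<^esub>) s ` carrier A"
    then obtain a b where ab: "a \<in> carrier A" "b \<in> carrier A" "x = u \<otimes>\<^bsub>A\<^esub> a \<oplus>\<^bsub>A\<^esub> s \<otimes>\<^bsub>A\<^esub> b"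
      by (auto simp: set_add_def set_mult_def)
    \<comment> \<open>Multiplying out, the mixed terms collect into a multiple of
      \<open>u \<otimes> s\<close>, which is zero. Hence \<open>u \<oplus> s\<close> acts as a unit
      on the sum of the two spaces.\<close>
    have "(u \<oplus>\<^bsub>A\<^esub> s) \<otimes>\<^bsub>A\<^esub> (u \<otimes>\<^bsub>A\<^esub> a \<oplus>\<^bsub>A\<^esub> s \<otimes>\<^bsub>A\<^esub> b)
        = (u \<otimes>\<^bsub>A\<^esub> u) \<otimes>\<^bsub>A\<^esub> a \<oplus>\<^bsub>A\<^esub> (s \<otimes>\<^bsub>A\<^esub> s) \<otimes>\<^bsub>A\<^esub> b \<oplus>\<^bsub>A\<^esub> (u \<otimes>\<^bsub>A\<^esub> s) \<otimes>\<^bsub>A\<^esub> (a \<oplus>\<^bsub>A\<^esub> b)"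
      using ab U s by algebra
    then have "x = (u \<oplus>\<^bsub>A\<^esub> s) \<otimes>\<^bsub>A\<^esub> x"
      using ab U s uu us ss by simp
    then show "x \<in> (\<otimes>\<^bsub>A\<^esub>) (u \<oplus>\<^bsub>A\<^esub> s) ` carrier A"
      using ab U s by (intro image_eqI[of _ _ x]) auto
  next
    fix x assume "x \<in> (\<otimes>\<^bsub>A\<^esub>) (u \<oplus>\<^bsub>A\<^esub> s) ` carrier A"
    then show "x \<in> (\<otimes>\<^bsub>A\<^esub>) u ` carrier A <+>\<^bsub>A\<^esub> (\<otimes>\<^bsub>A\<^esub>) s ` carrier A"
      using U s by (auto simp: set_add_def set_mult_def A.l_distr)
  qed
  moreover have "(\<Oplus>\<^bsub>A\<^esub>v\<in>insert u U. v) = u \<oplus>\<^bsub>A\<^esub> s"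
    unfolding s_def using U insert by (intro A.finsum_insert) auto
  ultimately show ?case
    using insert by simp
qed

lemma E_dimension: "ring.dimension E (card H) (scalars F E) (carrier E)"
proof -
  note K = scalars_subfield(2)[OF F.field_axioms A.algebra_axioms one_not_zero]
  \<comment> \<open>As a principal ideal, \<open>eA\<close> is a subalgebra over the scalars and
    inherits finite dimension from \<open>A\<close>. Only then is there a number \<open>m\<close> to
    count with.\<close>
  have PIdl: "carrier E = PIdl\<^bsub>A\<^esub> e"
    using e by (auto simp: component_def cgenideal_def A.m_comm image_iff)
  have "subalgebra (scalars F A) (carrier E) A"
    unfolding PIdl using A.subring_props(1)[OF K] e
    by (intro A.ideal_is_subalgebra A.cgenideal_ideal)
  then have "A.finite_dimension (scalars F A) (carrier E)"
    by (rule A.subalbegra_incl_imp_finite_dimension[OF K A.finite_dimensionI[OF degree]])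
       (auto simp: mem_E)
  then obtain m where m: "A.dimension m (scalars F A) (carrier E)" ..
  have "(\<otimes>\<^bsub>A\<^esub>) \<one>\<^bsub>A\<^esub> ` carrier A = carrier A"
    by (auto simp: image_iff)
  then have "A.dimension (card orb * m) (scalars F A) (carrier A)"
    using orb_component_dimension[OF m finite_orb subset_refl] by (simp add: orb_sum)
  then have "card orb * m = order G"
    by (rule A.dimension_is_inj[OF K _ degree])
  moreover have "card orb * card H = order G"
    using group_action.orbit_stabilizer_theorem[OF is_group_action e(1)] .
  moreover have "card orb > 0"
    using finite_orb e_in_orb by (auto simp: card_gt_0_iff)
  ultimately have "m = card H" by (metis mult_left_cancel not_gr_zero)
  \<comment> \<open>The identity map replaces the scalars of \<open>A\<close>, which are multiples
    of 1, by those of \<open>eA\<close>, which are multiples of \<open>e\<close>.\<close>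
  then have "ring.dimension E (card H) (scalars F E) ((\<lambda>x. x) ` carrier E)"
    using m by (intro dimension_linear_image[OF F.field_axioms A.algebra_axioms one_not_zero E_algebra]) auto
  then show ?thesis by simp
qed

text \<open>Artin's bound gives |H| = [eA : F] \<le> |\<psi>(H)|, and an image is never larger than
  its source, so \<open>\<psi>\<close> is injective on \<open>H\<close>. Dedekind's bound gives
  |Aut| \<le> [eA : F] = |\<psi>(H)|, so the image is the whole automorphism group. The condition on
  the characteristic passes to the stabilizer because |H| divides |G|.\<close>

lemma E_galois:
  assumes "\<not> characteristic F dvd order G"
  shows "galois_extension_field G\<^sub>e F E \<psi>"
    and "\<psi> \<in> iso G\<^sub>e (Aut_alg F E)"
proof -
  interpret E: algebra_action G\<^sub>e F E \<psi> by (rule E_action)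
  have fin: "finite H"
    using finite_group by (auto simp: stabilizer_def)
  have char: "\<not> characteristic F dvd order G\<^sub>e"
    using assms card_H_dvd dvd_trans by (auto simp: order_def)
  have "a \<in> scalars F E" if "a \<in> carrier E" "\<forall>h\<in>carrier G\<^sub>e. \<psi> h a = a" for a
    using E_invariants that by blast
  then have "card H \<le> card (\<psi> ` H)"
    using E.dimension_le_card_image[OF F.field_axioms E_field _ _ char E_dimension] fin by simp
  then have card: "card (\<psi> ` H) = card H"
    using card_image_le[OF fin, of \<psi>] by simp
  then have inj: "inj_on \<psi> H"
    using fin by (intro eq_card_imp_inj_on)
  have "\<psi> ` H \<subseteq> carrier (Aut_alg F E)"
    using E.act_Aut by auto
  then have surj: "\<psi> ` H = carrier (Aut_alg F E)"
    using card_Aut_alg_le_dimension[OF F.field_axioms E_algebra E_field E_dimension] card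
    by (intro card_seteq) auto
  show "\<psi> \<in> iso G\<^sub>e (Aut_alg F E)"
    using E.hom_Aut inj surj by (auto simp: iso_def bij_betw_def)
  have "galois_algebra G\<^sub>e F E \<psi>"
    using fin primitive_component_etale[OF etale primitive] E_dimension E.hom_Aut inj E_invariants
    by (intro galois_algebra.intro galois_algebra_axioms.intro E.is_group F.field_axioms E_algebra)
       (auto simp: order_def)
  then show "galois_extension_field G\<^sub>e F E \<psi>"
    using E_field by (simp add: galois_extension_field_def)
qed

end

section \<open>Separability in degree prime to the characteristic\<close>

text \<open>The tower law through K(x), whose dimension over \<open>K\<close> is the degree of the
  minimal polynomial.\<close>

lemma (in domain) degree_Irr_dvd_dimension:
  assumes K: "subfield K R" and dim: "dimension n K (carrier R)" and x: "x \<in> carrier R"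
  shows "(algebraic over K) x" "degree (Irr K x) dvd n"
proof -
  show alg: "(algebraic over K) x"
    using finite_dimension_imp_algebraic[OF K carrier_is_subring finite_dimensionI[OF dim] x] .
  let ?S = "simple_extension K x"
  have S: "subfield ?S R"
    using alg simple_extension_is_subfield[OF K x] by simp
  obtain Us where Us: "set Us \<subseteq> carrier R" "Span K Us = carrier R"
    using exists_base[OF K dim] by auto
  \<comment> \<open>A list that spans over \<open>K\<close> also spans over K(x). This gives the
    finiteness of the upper step that the tower law requires.\<close>
  have "Span K Us \<subseteq> Span ?S Us"
    unfolding Span_eq_combine_set[OF K Us(1)] Span_eq_combine_set[OF S Us(1)]
    using simple_extension_incl[OF subfieldE(3)[OF K] x] by blast
  moreover have "Span ?S Us \<subseteq> carrier R"
    using Span_subgroup_props(1)[OF S Us(1)] .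
  ultimately have "finite_dimension ?S (carrier R)"
    using Span_finite_dimension[OF S Us(1)] Us(2) by auto
  then have "(dim over K) (carrier R) = (dim over K) ?S * (dim over ?S) (carrier R)"
    using telescopic_base_dim(2)[OF K S] finite_dimension_simple_extension[OF K x] alg by blast
  then show "degree (Irr K x) dvd n"
    using simple_extension_dim[OF K x alg] dimI[OF K dim] by simp
qed

text \<open>By irreducibility, a common divisor of \<open>p\<close> and its derivative that is not a
  unit is an associate of \<open>p\<close>, so \<open>p\<close> would divide its derivative. That
  derivative is nonzero of smaller degree: its leading coefficient is the degree of \<open>p\<close>
  times 1, and the degree divides \<open>n\<close>.\<close>

lemma (in domain) separable_Irr:
  assumes K: "subfield K R" and dim: "dimension n K (carrier R)" and x: "x \<in> carrier R"
    and char: "add_pow R n \<one> \<noteq> \<zero>"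
  shows "separable_poly K (Irr K x)"
  unfolding separable_poly_def
proof (intro ballI impI, elim conjE)
  note alg = degree_Irr_dvd_dimension(1)[OF K dim x]
  note sub = subfieldE(1)[OF K]
  define p where "p = Irr K x"
  have p: "p \<in> carrier (K[X])" "pirreducible K p" "lead_coeff p = \<one>"
    using IrrE[OF K x alg] by (auto simp: p_def)
  have deg: "degree p \<ge> 1"
    using pirreducible_degree[OF K p(1,2)] .
  have pK: "set p \<subseteq> K" "p \<noteq> []"
    using p(1) deg by (auto simp: univ_poly_carrier[symmetric] polynomial_def)
  obtain l where "n = degree p * l"
    using degree_Irr_dvd_dimension(2)[OF K dim x] by (auto simp: p_def)
  then have lead: "add_pow R (degree p) \<one> \<noteq> \<zero>"
    using char add.nat_pow_pow[of \<one> l "degree p"] by (auto simp: mult.commute)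
  \<comment> \<open>The derivative before normalization. It has one coefficient fewer than
    \<open>p\<close>, hence degree one less, and its nonzero head makes normalization change
    nothing.\<close>
  define q where "q = map (\<lambda>i. add_pow R (degree p - i) (p ! i)) [0..<degree p]"
  have q: "length q = degree p" "lead_coeff q = add_pow R (degree p) \<one>"
    using deg pK p(3) by (auto simp: q_def hd_map upt_conv_Cons hd_conv_nth)
  have qK: "set q \<subseteq> K"
  proof -
    have "add_pow R k y \<in> K" if "y \<in> K" for k :: nat and y
      by (induction k) (use that subringE[OF sub] in auto)
    then show ?thesis using pK by (auto simp: q_def subset_eq)
  qed
  have "polynomial K q"
    using q qK lead by (auto simp: polynomial_def)
  then have pd: "poly_deriv p = q" "q \<in> carrier (K[X])"
    using normalize_polynomial by (auto simp: poly_deriv_def q_def univ_poly_carrier[symmetric])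
  interpret UP: domain "K[X]"
    using univ_poly_is_domain[OF sub] .
  fix d assume d: "d \<in> carrier (K[X])" "d divides\<^bsub>K[X]\<^esub> Irr K x"
    "d divides\<^bsub>K[X]\<^esub> poly_deriv (Irr K x)"
  then obtain c where c: "c \<in> carrier (K[X])" "p = d \<otimes>\<^bsub>K[X]\<^esub> c"
    by (auto simp: factor_def p_def)
  show "d \<in> Units (K[X])"
  proof (rule ccontr)
    assume "d \<notin> Units (K[X])"
    then have cu: "c \<in> Units (K[X])"
      using pirreducibleE(3)[OF sub p(1,2) d(1) c] by auto
    have "d = p \<otimes>\<^bsub>K[X]\<^esub> inv\<^bsub>K[X]\<^esub> c"
      using c d(1) cu by (simp add: UP.m_assoc)
    then have "p divides\<^bsub>K[X]\<^esub> d"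
      using cu by (intro dividesI[of "inv\<^bsub>K[X]\<^esub> c"]) auto
    then have "p divides\<^bsub>K[X]\<^esub> q"
      using UP.divides_trans[of p d q] d p pd by (simp add: p_def)
    then have "p pdivides q"
      using pdivides_iff[OF K] p(1) pd(2) by (simp add: univ_poly_carrier)
    moreover have "q \<noteq> []" using q deg by auto
    ultimately have "degree p \<le> degree q"
      using pdivides_imp_degree_le[OF sub p(1) pd(2)] by simp
    then show False using q deg by simp
  qed
qed

text \<open>Separability is read off from the dimension alone, so the factors of a transported
  algebra need only be shown to be fields of dimension |H|.\<close>

lemma finite_separable_extensionI:
  assumes "field F" "algebra F L" "field L"
    and "ring.dimension L n (scalars F L) (carrier L)"
    and "\<not> characteristic F dvd n"
  shows "finite_separable_extension F L"
proof -
  interpret L: field L by fact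
  note K = scalars_subfield[OF assms(1,2) L.one_not_zero]
  interpret A: algebra F L by fact
  have "add_pow F n \<one>\<^bsub>F\<^esub> \<noteq> \<zero>\<^bsub>F\<^esub>"
    using assms(5) characteristic_dvd_iff[OF cring.axioms(1)[OF A.R_cring]] by simp
  moreover have "add_pow F n \<one>\<^bsub>F\<^esub> \<in> carrier F" by simp
  ultimately have "add_pow L n \<one>\<^bsub>L\<^esub> \<noteq> \<zero>\<^bsub>F\<^esub> \<odot>\<^bsub>L\<^esub> \<one>\<^bsub>L\<^esub>"
    using K(1) by (auto simp: add_pow_one_smult[OF assms(2)] simp del: A.smult_l_null dest: inj_onD)
  then show ?thesis
    using L.separable_Irr[OF K(2) assms(4)] L.finite_dimensionI[OF assms(4)] assms
    by (auto simp: finite_separable_extension_def)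
qed

section \<open>Transport along isomorphisms\<close>

lemma alg_iso_inv_into:
  assumes "algebra F A" "f \<in> alg_iso F A B"
  shows "inv_into (carrier A) f \<in> alg_iso F B A"
proof -
  interpret A: algebra F A by fact
  have f: "f \<in> alg_hom F A B" and bij: "bij_betw f (carrier A) (carrier B)"
    using assms(2) by (auto simp: alg_iso_def)
  note hom = alg_homD[OF f]
  let ?g = "inv_into (carrier A) f"
  have g: "?g y \<in> carrier A" "f (?g y) = y" if "y \<in> carrier B" for y
    using bij that by (auto simp: bij_betw_def inv_into_into f_inv_into_f)
  have gI: "?g y = x" if "x \<in> carrier A" "f x = y" for x y
    using bij that by (auto simp: bij_betw_def)
  have "?g \<in> alg_hom F B A"
    using g hom by (intro alg_homI gI) auto
  then show ?thesis
    using bij_betw_inv_into[OF bij] by (simp add: alg_iso_def)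
qed

lemma alg_iso_trans:
  assumes "f \<in> alg_iso F A B" "g \<in> alg_iso F B C"
  shows "g \<circ> f \<in> alg_iso F A C"
proof -
  have "g \<circ> f \<in> alg_hom F A C"
    using alg_homD[of f F A B] alg_homD[of g F B C] assms
    by (intro alg_homI) (auto simp: alg_iso_def)
  then show ?thesis
    using assms by (auto simp: alg_iso_def intro: bij_betw_trans)
qed

text \<open>Etaleness of \<open>B\<close> is a hypothesis because its witnesses have to live on the
  element type of \<open>B\<close>. Degree, faithfulness and invariants are carried over by
  \<open>f\<close>.\<close>

lemma (in galois_algebra) galois_algebra_alg_iso:
  assumes "algebra_action G F B \<chi>" "etale F B" "\<one>\<^bsub>A\<^esub> \<noteq> \<zero>\<^bsub>A\<^esub>" "f \<in> alg_iso F A B"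
    and equivariant: "\<And>g a. \<lbrakk>g \<in> carrier G; a \<in> carrier A\<rbrakk> \<Longrightarrow> f (\<phi> g a) = \<chi> g (f a)"
  shows "galois_algebra G F B \<chi>"
proof -
  interpret B: algebra_action G F B \<chi> by fact
  have f: "f \<in> alg_hom F A B" and inj: "inj_on f (carrier A)" and surj: "f ` carrier A = carrier B"
    using assms(4) by (auto simp: alg_iso_def bij_betw_def)
  note hom = alg_homD[OF f]
  have "ring.dimension B (order G) (scalars F B) (f ` carrier A)"
    using inj hom degree
    by (intro dimension_linear_image[OF F.field_axioms A.algebra_axioms assms(3) B.A.algebra_axioms]) auto
  then have dim: "ring.dimension B (order G) (scalars F B) (carrier B)"
    by (simp add: surj)
  have inj_\<chi>: "inj_on \<chi> (carrier G)"
  proof (rule inj_onI)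
    fix g h assume gh: "g \<in> carrier G" "h \<in> carrier G" "\<chi> g = \<chi> h"
    have "\<phi> g a = \<phi> h a" if "a \<in> carrier A" for a
    proof (rule inj_onD[OF inj])
      show "f (\<phi> g a) = f (\<phi> h a)" using gh that equivariant by simp
    qed (use gh that in auto)
    then have "\<phi> g = \<phi> h"
      using act_Aut[OF gh(1)] act_Aut[OF gh(2)]
      by (intro extensionalityI[of _ "carrier A"]) (auto simp: Aut_alg_carrier Bij_def)
    then show "g = h" using action_inj gh by (auto dest: inj_onD)
  qed
  have "{b \<in> carrier B. \<forall>g\<in>carrier G. \<chi> g b = b} = f ` {a \<in> carrier A. \<forall>g\<in>carrier G. \<phi> g a = a}"
  proof (intro equalityI subsetI)
    fix b assume b: "b \<in> {b \<in> carrier B. \<forall>g\<in>carrier G. \<chi> g b = b}"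
    then obtain a where a: "a \<in> carrier A" "b = f a" using surj by auto
    have "\<phi> g a = a" if "g \<in> carrier G" for g
      using a b that equivariant[of g a] inj by (auto dest: inj_onD)
    then show "b \<in> f ` {a \<in> carrier A. \<forall>g\<in>carrier G. \<phi> g a = a}" using a by blast
  next
    fix b assume "b \<in> f ` {a \<in> carrier A. \<forall>g\<in>carrier G. \<phi> g a = a}"
    then show "b \<in> {b \<in> carrier B. \<forall>g\<in>carrier G. \<chi> g b = b}"
      using equivariant hom(2) by (auto simp: equivariant[symmetric])
  qed
  also have "\<dots> = scalars F B"
    unfolding invariants using hom by (force simp: scalars_def image_image)
  finally show ?thesis
    using finite_group assms(2) dim inj_\<chi> B.hom_Aut
    by (intro galois_algebra.intro galois_algebra_axioms.intro is_group F.field_axioms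
        B.A.algebra_axioms) auto
qed

section \<open>Induced algebras\<close>

lemma Ind_simps [simp]:
  "monoid.mult (Ind G H B \<psi>) = (\<lambda>\<sigma> \<tau>. \<lambda>g\<in>carrier G. \<sigma> g \<otimes>\<^bsub>B\<^esub> \<tau> g)"
  "one (Ind G H B \<psi>) = (\<lambda>g\<in>carrier G. \<one>\<^bsub>B\<^esub>)"
  "zero (Ind G H B \<psi>) = (\<lambda>g\<in>carrier G. \<zero>\<^bsub>B\<^esub>)"
  "add (Ind G H B \<psi>) = (\<lambda>\<sigma> \<tau>. \<lambda>g\<in>carrier G. \<sigma> g \<oplus>\<^bsub>B\<^esub> \<tau> g)"
  "smult (Ind G H B \<psi>) = (\<lambda>k \<tau>. \<lambda>g\<in>carrier G. k \<odot>\<^bsub>B\<^esub> \<tau> g)"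
  by (simp_all add: Ind_def)

lemma Ind_carrier_iff:
  "\<tau> \<in> carrier (Ind G H B \<psi>) \<longleftrightarrow>
    \<tau> \<in> extensional (carrier G) \<and> (\<forall>g\<in>carrier G. \<tau> g \<in> carrier B) \<and>
    (\<forall>h\<in>H. \<forall>g\<in>carrier G. \<tau> (h \<otimes>\<^bsub>G\<^esub> g) = \<psi> h (\<tau> g))"
  by (auto simp: Ind_def PiE_iff)

lemma Ind_eqI:
  assumes "\<sigma> \<in> carrier (Ind G H B \<psi>)" "\<tau> \<in> carrier (Ind G H B \<psi>)"
    and "\<And>g. g \<in> carrier G \<Longrightarrow> \<sigma> g = \<tau> g"
  shows "\<sigma> = \<tau>"
  using assms by (intro extensionalityI[of _ "carrier G"]) (auto simp: Ind_carrier_iff)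

lemma Ind_algebra_action:
  assumes "group G" "subgroup H G" "algebra_action (G\<lparr>carrier := H\<rparr>) F B \<psi>"
  shows "algebra_action G F (Ind G H B \<psi>) (Ind_action G H B \<psi>)"
proof -
  interpret G: group G by fact
  interpret H: subgroup H G by fact
  interpret B: algebra_action "G\<lparr>carrier := H\<rparr>" F B \<psi> by fact
  let ?I = "Ind G H B \<psi>" and ?\<rho> = "Ind_action G H B \<psi>"
  note act = B.act_mult[simplified] B.act_add[simplified] B.act_smult[simplified]
    B.act_one[simplified] B.act_zero[simplified]
  have HG: "h \<otimes>\<^bsub>G\<^esub> g \<in> carrier G" if "h \<in> H" "g \<in> carrier G" for h g
    using that by auto
  \<comment> \<open>Compatibility of \<open>\<psi> h\<close> with negation follows from additivity
    and the uniqueness of additive inverses.\<close>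
  have neg: "(\<lambda>g\<in>carrier G. \<ominus>\<^bsub>B\<^esub> \<tau> g) \<in> carrier ?I" if \<tau>: "\<tau> \<in> carrier ?I" for \<tau>
  proof -
    have "\<psi> h (\<ominus>\<^bsub>B\<^esub> x) = \<ominus>\<^bsub>B\<^esub> \<psi> h x" if "h \<in> H" "x \<in> carrier B" for h x
      using that act(2)[of h "\<ominus>\<^bsub>B\<^esub> x" x] act(5)[of h] B.act_closed[of h]
      by (simp add: B.A.l_neg B.A.minus_equality)
    then show ?thesis using \<tau> HG by (auto simp: Ind_carrier_iff)
  qed
  have "abelian_group ?I"
  proof (rule abelian_groupI)
    fix \<tau> assume \<tau>: "\<tau> \<in> carrier ?I"
    then show "\<exists>\<sigma>\<in>carrier ?I. \<sigma> \<oplus>\<^bsub>?I\<^esub> \<tau> = \<zero>\<^bsub>?I\<^esub>"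
      using neg[OF \<tau>]
      by (intro bexI[of _ "\<lambda>g\<in>carrier G. \<ominus>\<^bsub>B\<^esub> \<tau> g"])
         (auto simp: Ind_carrier_iff B.A.l_neg intro!: restrict_ext)
    show "\<zero>\<^bsub>?I\<^esub> \<oplus>\<^bsub>?I\<^esub> \<tau> = \<tau>"
      using \<tau> by (intro extensionalityI[of _ "carrier G"]) (auto simp: Ind_carrier_iff)
  qed (use HG act in \<open>auto simp: Ind_carrier_iff B.A.a_ac intro!: restrict_ext\<close>)
  moreover have "comm_monoid ?I"
  proof (rule comm_monoidI)
    fix \<tau> assume \<tau>: "\<tau> \<in> carrier ?I"
    show "\<one>\<^bsub>?I\<^esub> \<otimes>\<^bsub>?I\<^esub> \<tau> = \<tau>"
      using \<tau> by (intro extensionalityI[of _ "carrier G"]) (auto simp: Ind_carrier_iff)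
  qed (use HG act in \<open>auto simp: Ind_carrier_iff B.A.m_ac intro!: restrict_ext\<close>)
  ultimately have "cring ?I"
    by (intro cringI) (auto simp: Ind_carrier_iff B.A.l_distr intro!: restrict_ext)
  then have alg: "algebra F ?I"
  proof (intro algebraI B.A.R_cring)
    fix \<tau> assume \<tau>: "\<tau> \<in> carrier ?I"
    show "\<one>\<^bsub>F\<^esub> \<odot>\<^bsub>?I\<^esub> \<tau> = \<tau>"
      using \<tau> by (intro extensionalityI[of _ "carrier G"]) (auto simp: Ind_carrier_iff)
  qed (use HG act in \<open>auto simp: Ind_carrier_iff B.A.smult_l_distr B.A.smult_r_distr
      B.A.smult_assoc1 B.A.smult_assoc2 intro!: restrict_ext\<close>)
  interpret I: algebra F ?I by fact
  have app: "?\<rho> x \<tau> g = \<tau> (g \<otimes>\<^bsub>G\<^esub> x)" if "\<tau> \<in> carrier ?I" "g \<in> carrier G" for x \<tau> g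
    using that by (simp add: Ind_action_def)
  have closed: "?\<rho> x \<tau> \<in> carrier ?I" if "x \<in> carrier G" "\<tau> \<in> carrier ?I" for x \<tau>
    using that HG by (auto simp: Ind_action_def Ind_carrier_iff G.m_assoc)
  \<comment> \<open>Right translation is a left action: both sides take the value
    \<open>\<tau> (g \<otimes> x \<otimes> y)\<close> at \<open>g\<close>.\<close>
  have comp: "?\<rho> x (?\<rho> y \<tau>) = ?\<rho> (x \<otimes>\<^bsub>G\<^esub> y) \<tau>"
    if "x \<in> carrier G" "y \<in> carrier G" "\<tau> \<in> carrier ?I" for x y \<tau>
    using that closed by (intro Ind_eqI) (auto simp: app G.m_assoc)
  have one: "?\<rho> \<one>\<^bsub>G\<^esub> \<tau> = \<tau>" if "\<tau> \<in> carrier ?I" for \<tau>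
    using that closed by (intro Ind_eqI) (auto simp: app)
  have Aut: "?\<rho> x \<in> carrier (Aut_alg F ?I)" if x: "x \<in> carrier G" for x
  proof -
    have "?\<rho> x \<in> alg_hom F ?I ?I"
    proof (rule alg_homI)
      fix \<sigma> \<tau> assume st: "\<sigma> \<in> carrier ?I" "\<tau> \<in> carrier ?I"
      show "?\<rho> x (\<sigma> \<otimes>\<^bsub>?I\<^esub> \<tau>) = ?\<rho> x \<sigma> \<otimes>\<^bsub>?I\<^esub> ?\<rho> x \<tau>"
        using st x I.m_closed[OF st] by (intro ext) (auto simp: Ind_action_def)
      show "?\<rho> x (\<sigma> \<oplus>\<^bsub>?I\<^esub> \<tau>) = ?\<rho> x \<sigma> \<oplus>\<^bsub>?I\<^esub> ?\<rho> x \<tau>"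
        using st x I.a_closed[OF st] by (intro ext) (auto simp: Ind_action_def)
    next
      fix k \<tau> assume kt: "k \<in> carrier F" "\<tau> \<in> carrier ?I"
      show "?\<rho> x (k \<odot>\<^bsub>?I\<^esub> \<tau>) = k \<odot>\<^bsub>?I\<^esub> ?\<rho> x \<tau>"
        using kt x I.smult_closed[OF kt] by (intro ext) (auto simp: Ind_action_def)
    next
      show "?\<rho> x \<one>\<^bsub>?I\<^esub> = \<one>\<^bsub>?I\<^esub>"
        using x I.one_closed by (intro ext) (auto simp: Ind_action_def)
    qed (rule closed[OF x])
    moreover have "bij_betw (?\<rho> x) (carrier ?I) (carrier ?I)"
      using x closed by (intro bij_betw_byWitness[where f' = "?\<rho> (inv\<^bsub>G\<^esub> x)"]) (auto simp: comp one)
    ultimately show ?thesis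
      by (simp add: Aut_alg_carrier Bij_def Ind_action_def)
  qed
  have "?\<rho> \<in> hom G (Aut_alg F ?I)"
  proof (rule homI)
    fix x y assume xy: "x \<in> carrier G" "y \<in> carrier G"
    then have "?\<rho> (x \<otimes>\<^bsub>G\<^esub> y) = compose (carrier ?I) (?\<rho> x) (?\<rho> y)"
      by (intro extensionalityI[of _ "carrier ?I"]) (auto simp: comp compose_eq, simp add: Ind_action_def)
    then show "?\<rho> (x \<otimes>\<^bsub>G\<^esub> y) = ?\<rho> x \<otimes>\<^bsub>Aut_alg F ?I\<^esub> ?\<rho> y"
      using xy Aut by (simp add: Aut_alg_mult)
  qed (rule Aut)
  then show ?thesis
    by (intro algebra_action.intro G.is_group alg algebra_action_axioms.intro)
qed

section \<open>The isomorphism with the induced algebra\<close>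

context galois_algebra_idempotent
begin

definition to_Ind :: "'a \<Rightarrow> 'g \<Rightarrow> 'a" where
  "to_Ind a = (\<lambda>g\<in>carrier G. e \<otimes>\<^bsub>A\<^esub> \<phi> g a)"

lemma to_Ind_apply [simp]: "g \<in> carrier G \<Longrightarrow> to_Ind a g = e \<otimes>\<^bsub>A\<^esub> \<phi> g a"
  by (simp add: to_Ind_def)

lemma e_mult_E: "a \<in> carrier A \<Longrightarrow> e \<otimes>\<^bsub>A\<^esub> a \<in> carrier E"
  by (auto simp: component_def)

text \<open>An element of the stabilizer fixes \<open>e\<close>, so it can be moved past the factor
  \<open>e\<close>.\<close>

lemma to_Ind_closed:
  assumes a: "a \<in> carrier A"
  shows "to_Ind a \<in> carrier (Ind G H E \<psi>)"
proof -
  have "e \<otimes>\<^bsub>A\<^esub> \<phi> (h \<otimes> g) a = \<psi> h (e \<otimes>\<^bsub>A\<^esub> \<phi> g a)" if h: "h \<in> H" and g: "g \<in> carrier G" for h g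
    using a h g e e_mult_E[of "\<phi> g a"] by (simp add: H_iff act_mult act_act)
  then show ?thesis
    using a e_mult_E by (auto simp: Ind_carrier_iff to_Ind_def H_iff)
qed

text \<open>The value of \<open>to_Ind a\<close> at \<open>g\<close> and the component of
  \<open>a\<close> at \<open>\<phi> (inv g) e\<close> determine each other. Injectivity and
  surjectivity of \<open>to_Ind\<close> both come down to this.\<close>

lemma orb_mult_eq_act:
  assumes "a \<in> carrier A" "g \<in> carrier G"
  shows "\<phi> (inv g) e \<otimes>\<^bsub>A\<^esub> a = \<phi> (inv g) (e \<otimes>\<^bsub>A\<^esub> \<phi> g a)"
  using assms e by (simp add: act_mult)

lemma to_Ind_inj: "inj_on to_Ind (carrier A)"
proof (rule inj_onI)
  fix a b assume ab: "a \<in> carrier A" "b \<in> carrier A" "to_Ind a = to_Ind b"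
  show "a = b"
  proof (rule eq_via_orb)
    fix u assume "u \<in> orb"
    then obtain g where g: "g \<in> carrier G" "u = \<phi> g e" by (auto simp: orbit_def)
    have "e \<otimes>\<^bsub>A\<^esub> \<phi> (inv g) a = e \<otimes>\<^bsub>A\<^esub> \<phi> (inv g) b"
      using ab(3) g to_Ind_apply[of "inv g" a] to_Ind_apply[of "inv g" b] by simp
    then show "u \<otimes>\<^bsub>A\<^esub> a = u \<otimes>\<^bsub>A\<^esub> b"
      using orb_mult_eq_act[of a "inv g"] orb_mult_eq_act[of b "inv g"] ab g by simp
  qed (use ab in auto)
qed

text \<open>A preimage of \<open>\<tau>\<close> is glued from its values at one representative of each coset of the
  stabilizer.\<close>
lemma to_Ind_surj:
  assumes \<tau>: "\<tau> \<in> carrier (Ind G H E \<psi>)"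
  shows "\<tau> \<in> to_Ind ` carrier A"
proof
  have \<tau>E: "\<tau> g \<in> carrier E" "\<tau> g \<in> carrier A" "e \<otimes>\<^bsub>A\<^esub> \<tau> g = \<tau> g" if "g \<in> carrier G" for g
    using \<tau> that by (auto simp: Ind_carrier_iff mem_E)
  \<comment> \<open>The value at \<open>g\<close> encodes the component at the translate of
    \<open>e\<close> by \<open>inv g\<close>. The component at \<open>u\<close> is hence read off at
    the inverse of \<open>rep u\<close> and moved back.\<close>
  define f where "f u = \<phi> (rep u) (\<tau> (inv (rep u)))" for u
  have f: "f u \<in> carrier A \<and> u \<otimes>\<^bsub>A\<^esub> f u = f u" if "u \<in> orb" for u
    using rep[OF that] \<tau>E[of "inv (rep u)"] e act_mult[of "rep u" e "\<tau> (inv (rep u))"]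
    by (simp add: f_def)
  define a where "a = (\<Oplus>\<^bsub>A\<^esub>u\<in>orb. f u)"
  show a: "a \<in> carrier A"
    unfolding a_def using f by (intro A.finsum_closed) auto
  show "\<tau> = to_Ind a"
  proof (rule Ind_eqI[OF \<tau> to_Ind_closed[OF a]])
    fix g assume g: "g \<in> carrier G"
    define u where "u = \<phi> (inv g) e"
    have u: "u \<in> orb" using g e_in_orb orb_act by (simp add: u_def)
    note r = rep[OF u]
    have h: "g \<otimes> rep u \<in> H"
      using H_intro[of "rep u" "inv g"] r g by (simp add: u_def)
    have "\<phi> (inv g) (e \<otimes>\<^bsub>A\<^esub> \<phi> g a) = f u"
      using orb_mult_finsum[OF u f] orb_mult_eq_act[OF a g] by (simp add: u_def a_def)
    then have "e \<otimes>\<^bsub>A\<^esub> \<phi> g a = \<phi> g (f u)"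
      using g a e act_inv_act(2)[of g "e \<otimes>\<^bsub>A\<^esub> \<phi> g a"] by simp
    also have "\<dots> = \<phi> (g \<otimes> rep u) (\<tau> (inv (rep u)))"
      using r g \<tau>E by (simp add: f_def act_act)
    \<comment> \<open>The equivariance of \<open>\<tau>\<close>, applied to the stabilizer element
      \<open>g \<otimes> rep u\<close>.\<close>
    also have "\<dots> = \<tau> (g \<otimes> rep u \<otimes> inv (rep u))"
      using \<tau> h r \<tau>E by (simp add: Ind_carrier_iff)
    also have "\<dots> = \<tau> g"
      using r g by (simp add: m_assoc)
    finally show "\<tau> g = to_Ind a g" using g by simp
  qed
qed

lemma to_Ind_alg_iso: "to_Ind \<in> alg_iso F A (Ind G H E \<psi>)"
proof -
  have "to_Ind \<in> alg_hom F A (Ind G H E \<psi>)"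
  proof (rule alg_homI)
    fix a b assume ab: "a \<in> carrier A" "b \<in> carrier A"
    have "e \<otimes>\<^bsub>A\<^esub> (x \<otimes>\<^bsub>A\<^esub> y) = (e \<otimes>\<^bsub>A\<^esub> x) \<otimes>\<^bsub>A\<^esub> (e \<otimes>\<^bsub>A\<^esub> y)"
      if "x \<in> carrier A" "y \<in> carrier A" for x y
    proof -
      have "(e \<otimes>\<^bsub>A\<^esub> x) \<otimes>\<^bsub>A\<^esub> (e \<otimes>\<^bsub>A\<^esub> y) = (e \<otimes>\<^bsub>A\<^esub> e) \<otimes>\<^bsub>A\<^esub> (x \<otimes>\<^bsub>A\<^esub> y)"
        using that e(1) by algebra
      then show ?thesis using e by simp
    qed
    then show "to_Ind (a \<otimes>\<^bsub>A\<^esub> b) = to_Ind a \<otimes>\<^bsub>Ind G H E \<psi>\<^esub> to_Ind b"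
      using ab by (auto simp: to_Ind_def act_mult intro!: restrict_ext)
    show "to_Ind (a \<oplus>\<^bsub>A\<^esub> b) = to_Ind a \<oplus>\<^bsub>Ind G H E \<psi>\<^esub> to_Ind b"
      using ab e by (auto simp: to_Ind_def act_add A.r_distr intro!: restrict_ext)
  next
    fix k a assume ka: "k \<in> carrier F" "a \<in> carrier A"
    have "e \<otimes>\<^bsub>A\<^esub> (k \<odot>\<^bsub>A\<^esub> x) = k \<odot>\<^bsub>A\<^esub> (e \<otimes>\<^bsub>A\<^esub> x)" if "x \<in> carrier A" for x
      using that ka e A.smult_assoc2[of k x e] by (simp add: A.m_comm)
    then show "to_Ind (k \<odot>\<^bsub>A\<^esub> a) = k \<odot>\<^bsub>Ind G H E \<psi>\<^esub> to_Ind a"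
      using ka by (auto simp: to_Ind_def act_smult intro!: restrict_ext)
  next
    show "to_Ind \<one>\<^bsub>A\<^esub> = \<one>\<^bsub>Ind G H E \<psi>\<^esub>"
      using e by (auto simp: to_Ind_def intro!: restrict_ext)
  qed (rule to_Ind_closed)
  moreover have "bij_betw to_Ind (carrier A) (carrier (Ind G H E \<psi>))"
    using to_Ind_inj to_Ind_closed to_Ind_surj by (auto simp: bij_betw_def)
  ultimately show ?thesis by (simp add: alg_iso_def)
qed

lemma to_Ind_equivariant:
  assumes "x \<in> carrier G" "a \<in> carrier A"
  shows "to_Ind (\<phi> x a) = Ind_action G H E \<psi> x (to_Ind a)"
  using assms to_Ind_closed[of a]
  by (auto simp: to_Ind_def Ind_action_def act_act intro!: restrict_ext)

text \<open>The factors of an etale algebra have to live on its own element type, so those of an algebra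
  isomorphic to \<open>A\<close> are taken to be its components rather than those of \<open>A\<close>.\<close>
lemma etale_alg_iso:
  fixes B :: "('f, 'b) module"
  assumes "algebra F B" "f \<in> alg_iso F A B" and char: "\<not> characteristic F dvd order G"
  shows "etale F B"
proof -
  interpret B: algebra F B by fact
  interpret E: algebra F E by (rule E_algebra)
  have f: "f \<in> alg_hom F A B" and inj: "inj_on f (carrier A)" and surj: "f ` carrier A = carrier B"
    using assms(2) by (auto simp: alg_iso_def bij_betw_def)
  note hom = alg_homD[OF f]
  have f0: "f \<zero>\<^bsub>A\<^esub> = \<zero>\<^bsub>B\<^esub>"
    using ring_hom_zero[OF hom(1) A.ring_axioms B.ring_axioms] .
  define L where "L u = component B (f u)" for u
  have idem: "f u \<in> idempotents B" if u: "u \<in> orb" for u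
  proof -
    obtain g where g: "g \<in> carrier G" "u = \<phi> g e" using u by (auto simp: orbit_def)
    have "u \<noteq> \<zero>\<^bsub>A\<^esub>" using g e act_inj[OF g(1)] by (metis A.zero_closed act_zero inj_onD)
    then have "f u \<noteq> \<zero>\<^bsub>B\<^esub>"
      using inj orb_closed[OF u] f0 by (metis A.zero_closed inj_onD)
    then show ?thesis
      using u orb_closed orb_idempotent hom(2) hom(3)[of u u] by (auto simp: idempotents_def)
  qed
  have L_alg: "algebra F (L u)" if "u \<in> orb" for u
    unfolding L_def using component_algebra[OF assms(1) idem[OF that]] .
  have L_carrier: "carrier (L u) = f ` ((\<otimes>\<^bsub>A\<^esub>) u ` carrier A)" if "u \<in> orb" for u
    unfolding L_def component_def using that orb_closed hom(3) surj[symmetric]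
    by (auto simp: image_image)
  have L_simps [simp]: "monoid.mult (L u) = monoid.mult B" "one (L u) = f u"
    "add (L u) = add B" "smult (L u) = smult B" for u
    by (simp_all add: L_def)
  have L_sep: "finite_separable_extension F (L u)" if u: "u \<in> orb" for u
  proof -
    \<comment> \<open>Translation carries \<open>eA\<close> onto \<open>uA\<close>, and
      \<open>f\<close> carries that onto the component of \<open>B\<close> at \<open>f u\<close>.
      Along this composite the factor becomes a field of dimension |H|, which is prime to the
      characteristic.\<close>
    define h where "h x = f (\<phi> (rep u) x)" for x
    note r = rep[OF u]
    have im: "h ` carrier E = carrier (L u)"
    proof -
      have "\<phi> (rep u) ` carrier E = (\<otimes>\<^bsub>A\<^esub>) u ` carrier A"
        using act_component_carrier[OF r(1)] r(2) by simp
      then show ?thesis using L_carrier[OF u] by (simp add: h_def image_image[symmetric])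
    qed
    have EA: "x \<in> carrier A" if "x \<in> carrier E" for x using that by (simp add: mem_E)
    have h: "h \<in> alg_hom F E (L u)"
      using im r EA hom by (intro alg_homI) (auto simp: h_def act_mult act_add act_smult)
    have h_inj: "inj_on h (carrier E)"
    proof (rule inj_onI)
      fix x y assume xy: "x \<in> carrier E" "y \<in> carrier E" "h x = h y"
      then have "\<phi> (rep u) x = \<phi> (rep u) y"
        using inj EA r by (auto simp: h_def dest!: inj_onD)
      then show "x = y"
        using act_inj[OF r(1)] EA xy by (auto dest: inj_onD)
    qed
    have "h \<in> alg_iso F E (L u)"
      using h h_inj im by (simp add: alg_iso_def bij_betw_def)
    then have "field (L u)"
      using field_alg_iso[OF algebra.M_cring[OF L_alg[OF u]] E_field alg_iso_inv_into[OF E_algebra]] by blast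
    moreover have "ring.dimension (L u) (card H) (scalars F (L u)) (h ` carrier E)"
      using h_inj alg_homD[OF h] e
      by (intro dimension_linear_image[OF F.field_axioms E_algebra _ L_alg[OF u] E_dimension]) auto
    moreover have "\<not> characteristic F dvd card H"
      using char card_H_dvd by (meson dvd_trans)
    ultimately show ?thesis
      using finite_separable_extensionI[OF F.field_axioms L_alg[OF u]] im by simp
  qed
  \<comment> \<open>The factors in \<open>etale\<close> are indexed by an initial segment of the
    naturals, so the orbit is enumerated.\<close>
  obtain us where us: "bij_betw us {0..<card orb} orb"
    using ex_bij_betw_nat_finite[OF finite_orb] by auto
  define n where "n = card orb"
  have us_orb: "us i \<in> orb" if "i < n" for i
    using us that by (auto simp: bij_betw_def n_def)
  have us_surj: "\<exists>i<n. u = us i" if "u \<in> orb" for u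
  proof -
    have "u \<in> us ` {0..<card orb}"
      using that us by (simp add: bij_betw_def)
    then show ?thesis by (auto simp: n_def)
  qed
  let ?P = "prod_algebra {..<n} (\<lambda>i. L (us i))"
  define p where "p a = (\<lambda>i\<in>{..<n}. f (us i \<otimes>\<^bsub>A\<^esub> a))" for a
  have "p \<in> alg_iso F A ?P"
  proof -
    have cl: "us i \<otimes>\<^bsub>A\<^esub> a \<in> carrier A" if "i < n" "a \<in> carrier A" for i a
      using us_orb that orb_closed by auto
    have "p \<in> alg_hom F A ?P"
    proof (rule alg_homI)
      fix a assume "a \<in> carrier A"
      then show "p a \<in> carrier ?P"
        using us_orb by (auto simp: p_def prod_algebra_def L_carrier)
    next
      fix a b assume ab: "a \<in> carrier A" "b \<in> carrier A"
      have "f (us i \<otimes>\<^bsub>A\<^esub> (a \<otimes>\<^bsub>A\<^esub> b)) = f (us i \<otimes>\<^bsub>A\<^esub> a) \<otimes>\<^bsub>B\<^esub> f (us i \<otimes>\<^bsub>A\<^esub> b)" if i: "i < n" for i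
      proof -
        have u: "us i \<in> carrier A" "us i \<otimes>\<^bsub>A\<^esub> us i = us i"
          using us_orb[OF i] orb_closed orb_idempotent by auto
        have "(us i \<otimes>\<^bsub>A\<^esub> a) \<otimes>\<^bsub>A\<^esub> (us i \<otimes>\<^bsub>A\<^esub> b) = (us i \<otimes>\<^bsub>A\<^esub> us i) \<otimes>\<^bsub>A\<^esub> (a \<otimes>\<^bsub>A\<^esub> b)"
          using u(1) ab by algebra
        then show ?thesis
          using u hom(3)[of "us i \<otimes>\<^bsub>A\<^esub> a" "us i \<otimes>\<^bsub>A\<^esub> b"] ab by simp
      qed
      then show "p (a \<otimes>\<^bsub>A\<^esub> b) = p a \<otimes>\<^bsub>?P\<^esub> p b"
        by (auto simp: p_def prod_algebra_def intro!: restrict_ext)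
      show "p (a \<oplus>\<^bsub>A\<^esub> b) = p a \<oplus>\<^bsub>?P\<^esub> p b"
        using ab cl us_orb orb_closed hom(4)
        by (auto simp: p_def prod_algebra_def A.r_distr intro!: restrict_ext)
    next
      fix k a assume ka: "k \<in> carrier F" "a \<in> carrier A"
      have "f (us i \<otimes>\<^bsub>A\<^esub> (k \<odot>\<^bsub>A\<^esub> a)) = k \<odot>\<^bsub>B\<^esub> f (us i \<otimes>\<^bsub>A\<^esub> a)" if i: "i < n" for i
      proof -
        have "us i \<in> carrier A" using us_orb[OF i] orb_closed by auto
        then show ?thesis
          using ka cl[OF i ka(2)] hom(6) A.smult_assoc2[of k a "us i"] by (simp add: A.m_comm)
      qed
      then show "p (k \<odot>\<^bsub>A\<^esub> a) = k \<odot>\<^bsub>?P\<^esub> p a"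
        by (auto simp: p_def prod_algebra_def intro!: restrict_ext)
    next
      show "p \<one>\<^bsub>A\<^esub> = \<one>\<^bsub>?P\<^esub>"
        using us_orb orb_closed by (auto simp: p_def prod_algebra_def intro!: restrict_ext)
    qed
    moreover have "inj_on p (carrier A)"
    proof (rule inj_onI)
      fix a b assume ab: "a \<in> carrier A" "b \<in> carrier A" "p a = p b"
      show "a = b"
      proof (rule eq_via_orb)
        fix u assume u: "u \<in> orb"
        then obtain i where i: "i < n" "u = us i"
          using us_surj by auto
        have "f (us i \<otimes>\<^bsub>A\<^esub> a) = f (us i \<otimes>\<^bsub>A\<^esub> b)"
          using fun_cong[OF ab(3), of i] i by (simp add: p_def)
        then show "u \<otimes>\<^bsub>A\<^esub> a = u \<otimes>\<^bsub>A\<^esub> b"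
          using inj cl i ab by (auto dest: inj_onD)
      qed (use ab in auto)
    qed
    moreover have "y \<in> p ` carrier A" if y: "y \<in> carrier ?P" for y
    proof -
      \<comment> \<open>The tuple \<open>y\<close> prescribes, at the index of \<open>u\<close>, an
        element of the component of \<open>B\<close> at \<open>f u\<close>. Its preimage
        \<open>b u\<close> lies in \<open>uA\<close>, and these pieces glue to a preimage of
        \<open>y\<close>.\<close>
      define b where "b u = inv_into (carrier A) f (y (inv_into {0..<card orb} us u))" for u
      have b: "b (us i) \<in> carrier A" "us i \<otimes>\<^bsub>A\<^esub> b (us i) = b (us i)" "f (b (us i)) = y i"
        if i: "i < n" for i
      proof -
        have "y i \<in> carrier (L (us i))"
          using y i by (auto simp: prod_algebra_def)
        then obtain c where c: "c \<in> carrier A" "y i = f (us i \<otimes>\<^bsub>A\<^esub> c)"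
          using L_carrier us_orb[OF i] by auto
        have u: "us i \<in> carrier A" "us i \<otimes>\<^bsub>A\<^esub> us i = us i"
          using us_orb[OF i] orb_closed orb_idempotent by auto
        have "inv_into {0..<card orb} us (us i) = i"
          using us i by (auto simp: bij_betw_def n_def)
        then have "b (us i) = us i \<otimes>\<^bsub>A\<^esub> c"
          using c u inv_into_f_f[OF inj] by (simp add: b_def)
        then show "b (us i) \<in> carrier A" "us i \<otimes>\<^bsub>A\<^esub> b (us i) = b (us i)" "f (b (us i)) = y i"
          using c u by (auto simp: A.m_assoc[symmetric])
      qed
      have b_orb: "b u \<in> carrier A \<and> u \<otimes>\<^bsub>A\<^esub> b u = b u" if u: "u \<in> orb" for u
      proof -
        obtain i where "i < n" "u = us i"
          using us_surj[OF u] by blast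
        then show ?thesis using b(1,2) by blast
      qed
      define a where "a = (\<Oplus>\<^bsub>A\<^esub>u\<in>orb. b u)"
      have "a \<in> carrier A"
        unfolding a_def using b_orb by (intro A.finsum_closed) auto
      moreover have "y = p a"
      proof (rule extensionalityI[of _ "{..<n}"])
        show "y \<in> extensional {..<n}" using y by (simp add: prod_algebra_def PiE_def)
        fix i assume i: "i \<in> {..<n}"
        then have "us i \<otimes>\<^bsub>A\<^esub> a = b (us i)"
          unfolding a_def using b_orb us_orb by (intro orb_mult_finsum) auto
        then show "y i = p a i" using b i by (simp add: p_def)
      qed (simp add: p_def)
      ultimately show ?thesis by blast
    qed
    ultimately show ?thesis
      using alg_homD(2)[of p F A ?P] by (auto simp: alg_iso_def bij_betw_def)
  qed
  then have "p \<circ> inv_into (carrier A) f \<in> alg_iso F B ?P"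
    by (rule alg_iso_trans[OF alg_iso_inv_into[OF A.algebra_axioms assms(2)]])
  then show ?thesis
    using assms(1) L_sep us_orb unfolding etale_def
    by (intro conjI exI[of _ n] exI[of _ "\<lambda>i. L (us i)"]) auto
qed

text \<open>Isomorphism of Galois algebras includes that the target is one, so besides the bijection
  \<open>to_Ind\<close> the etaleness of the induced algebra has to be supplied.\<close>

lemma isomorphic_Ind:
  assumes "\<not> characteristic F dvd order G"
  shows "galois_algebra_isomorphic G F A \<phi> (Ind G H E \<psi>) (Ind_action G H E \<psi>)"
proof -
  have "algebra_action G F (Ind G H E \<psi>) (Ind_action G H E \<psi>)"
    using is_group H_subgroup E_action by (rule Ind_algebra_action)
  then have "galois_algebra G F (Ind G H E \<psi>) (Ind_action G H E \<psi>)"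
    using etale_alg_iso[OF algebra_action.axioms(2)[OF \<open>algebra_action G F (Ind G H E \<psi>) _\<close>] to_Ind_alg_iso assms]
      one_not_zero to_Ind_alg_iso to_Ind_equivariant by (rule galois_algebra_alg_iso)
  then show ?thesis
    unfolding galois_algebra_isomorphic_def galois_algebra_hom_def
    using galois_algebra_axioms to_Ind_alg_iso to_Ind_equivariant by (auto simp: alg_iso_def)
qed

end

theorem theorem1p4:
  fixes G :: "('g, 'p) monoid_scheme"
    and F :: "('f, 'k) ring_scheme"
    and A :: "('f, 'a, 'm) module_scheme"
    and \<phi> :: "'g \<Rightarrow> 'a \<Rightarrow> 'a"
    and e :: 'a
  assumes "group G" and "finite (carrier G)"
    and "field F" and "\<not> characteristic F dvd order G"
    and "galois_algebra G F A \<phi>"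
    and "e \<in> primitive_idempotents A"
  shows "galois_extension_field (G\<lparr>carrier := stabilizer G \<phi> e\<rparr>) F
           (component A e) (component_action A \<phi> e)
    \<and> component_action A \<phi> e
           \<in> iso (G\<lparr>carrier := stabilizer G \<phi> e\<rparr>) (Aut_alg F (component A e))
    \<and> galois_algebra_isomorphic G F A \<phi>
           (Ind G (stabilizer G \<phi> e) (component A e) (component_action A \<phi> e))
           (Ind_action G (stabilizer G \<phi> e) (component A e) (component_action A \<phi> e))"
proof -
  interpret galois_algebra_idempotent G F A \<phi> e
    using assms by (simp add: galois_algebra_idempotent_def galois_algebra_idempotent_axioms_def)
  show ?thesis
    using E_galois[OF assms(4)] isomorphic_Ind[OF assms(4)] by blast
qed

end
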